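(* Let $\mu,\mu_1,\mu_2,\ldots$ be Radon measures on $S$. Assume: (B1) the transition density $p$ is jointly continuous on $(0,\infty)\times S\times S$ with values in $[0,\infty)$; (B2) each of $\mu,\mu_1,\mu_2,\ldots$ charges no semipolar sets, and $\mu_n\to\mu$ vaguely, i.e. $\lim_{n\to\infty}\int_S f\,d\mu_n=\int_S f\,d\mu$ for all compactly supported continuous functions $f:S\to\mathbb R$; (B3) for any compact subset $K$ of $S$, $$\lim_{t\to0}\ \sup_{n\ge1}\ \sup_{x\in K}\int_0^t\int_K p_s(x,y)\,\mu_n(dy)\,ds=0 .$$ Then there exists an increasing sequence $(V_k)_{k\ge1}$ of relatively compact open subsets of $S$ with $\bigcup_{k\ge1}V_k=S$ such that, for every $k\ge1$, $\mu^{V_k}\in\mathcal S_{00}$, $\mu_n^{V_k}\in\mathcal S_{00}$ for all $n\ge1$, and $$\lim_{n\to\infty}\|R_1\mu_n^{V_k}-R_1\mu^{V_k}\|_{L^\infty(S,\,\mu_n^{V_k}+\mu^{V_k})}=0 .$$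
   Context: Setting. $S$ is a locally compact separable metrizable space; $S_\Delta=S\cup\{\Delta\}$ is its one-point compactification ($\Delta$ isolated if $S$ is compact). Functions $f$ on $S$ are extended by $f(\Delta)=0$; $\inf\emptyset=\infty$. $X=(\Omega,\mathscr M,(X_t)_{t\in[0,\infty]},(P_x)_{x\in S_\Delta},(\theta_t)_{t\in[0,\infty]})$ is a standard process on $S$ (a normal, right-continuous strong Markov process with cemetery $\Delta$, having left limits and quasi-left-continuous on $[0,\zeta)$, where $\zeta=\inf\{t: X_t=\Delta\}$ is the lifetime; $X_\infty=\Delta$; $\theta_t$ are shift operators). Standing assumption (duality and absolute continuity): there exist another standard process $\hat X$ on $S$ with laws $\hat P_x$, a $\sigma$-finite Borel measure $m$ on $S$ and a Borel measurable function $p:(0,\infty)\times S\times S\to[0,\infty]$ (the transition density) such that for all $s,t>0$, $x,y\in S$: $P_x(X_t\in dy)=p_t(x,y)\,m(dy)$; $\hat P_y(\hat X_t\in dx)=p_t(x,y)\,m(dx)$; $p_{t+s}(x,y)=\int_S p_t(x,z)p_s(z,y)\,m(dz)$. Notation. $r_1(x,y)=\int_0^\infty e^{-t}p_t(x,y)\,dt$ and, for a Borel measure $\mu$, $R_1\mu(x)=\int_S r_1(x,y)\,\mu(dy)$. $\mu^E(dx)=1_E(x)\mu(dx)$. $\|f\|_\infty=\sup_{x\in S}|f(x)|$; $\|f\|_{L^\infty(S,\nu)}=\inf\{C>0:|f|\le C\ \nu\text{-a.e.}\}$. For Borel $E\subseteq S$, $\sigma_E=\inf\{t\in(0,\infty):X_t\in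 E\}$. A set is thin if it is contained in a nearly Borel set $B$ with $P_x(\sigma_B=0)=0$ for all $x$; a set is semipolar if it is contained in a countable union of thin sets. $\mathcal S_{00}$ is the set of finite Borel measures $\mu$ on $S$ charging no semipolar set with $\|R_1\mu\|_\infty<\infty$. *)

theory Defs
  imports "HOL-Probability.Probability"
begin

section \<open>The one-point compactification\<close>

text \<open>
  The state space is a type \<open>'a\<close>; its one-point compactification lives on \<open>'a option\<close>, with
  \<^term>\<open>None\<close> as cemetery. A compact closed complement of a neighbourhood of \<^term>\<open>None\<close> may be
  the whole space, so \<^term>\<open>None\<close> is isolated if the state space is compact.
\<close>

definition top_Delta :: "'a::topological_space option topology" where
  "top_Delta = Alexandroff_compactification euclidean"

definition borel_Delta :: "'a::topological_space option measure" where
  "borel_Delta = sigma UNIV {U. openin top_Delta U}"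

definition initial_laws :: "'a::topological_space option measure set" where
  "initial_laws = {\<nu>. prob_space \<nu> \<and> sets \<nu> = sets borel_Delta}"


section \<open>Standard processes\<close>

text \<open>
  The tuple of sample space with its events, random variables, laws and shift operators.
  Only the space and the \<open>\<sigma>\<close>-algebra of \<^term>\<open>events\<close> are used. Time ranges over \<open>[0, \<infinity>]\<close>.
\<close>

record ('w, 'a) process =
  events :: "'w measure"
  path :: "ennreal \<Rightarrow> 'w \<Rightarrow> 'a option"
  law :: "'a option \<Rightarrow> 'w measure"
  shift :: "ennreal \<Rightarrow> 'w \<Rightarrow> 'w"

abbreviation samples :: "('w, 'a) process \<Rightarrow> 'w set" where
  "samples X \<equiv> space (events X)"

definition lifetime :: "('w, 'a) process \<Rightarrow> 'w \<Rightarrow> ennreal" where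
  "lifetime X \<omega> = Inf {t. path X t \<omega> = None}"

definition natural_filtration ::
    "('w, 'a::topological_space) process \<Rightarrow> ennreal \<Rightarrow> 'w measure" where
  "natural_filtration X t =
     sigma (samples X) {path X s -` B \<inter> samples X |s B. s \<le> t \<and> B \<in> sets borel_Delta}"

text \<open>
  The law \<open>P\<^sub>\<nu> = \<integral> P\<^sub>x \<nu>(dx)\<close> on the \<open>\<sigma>\<close>-algebra generated by the paths, the only one on which
  \<open>x \<mapsto> P\<^sub>x(A)\<close> is required to be measurable.
\<close>

definition law_from ::
    "('w, 'a::topological_space) process \<Rightarrow> 'a option measure \<Rightarrow> 'w measure" where
  "law_from X \<nu> =
     measure_of (samples X) (sets (natural_filtration X \<infinity>)) (\<lambda>A. \<integral>\<^sup>+x. emeasure (law X x) A \<partial>\<nu>)"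

text \<open>
  The minimum augmented admissible filtration: for every initial law add the null sets of the
  completed law, then intersect over all initial laws.
\<close>

definition augmented_filtration ::
    "('w, 'a::topological_space) process \<Rightarrow> ennreal \<Rightarrow> 'w measure" where
  "augmented_filtration X t =
     sigma (samples X) (\<Inter>\<nu>\<in>initial_laws.
       sigma_sets (samples X)
         (sets (natural_filtration X t) \<union> null_sets (completion (law_from X \<nu>))))"

text \<open>
  The strong Markov property is the identity
  \<open>P\<^sub>\<nu>(X\<^bsub>T+s\<^esub> \<in> B | F\<^sub>T) = P\<^bsub>X\<^sub>T\<^esub>(X\<^sub>s \<in> B)\<close> almost surely; on \<open>T = \<infinity>\<close> it is trivial because
  \<open>X\<^sub>\<infinity>\<close> is the cemetery. Left limits on \<open>(0, \<zeta>)\<close> are limits in the state space.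
\<close>

locale standard_process =
  fixes X :: "('w, 'a::topological_space) process"
  assumes prob_space_law: "\<And>x. prob_space (law X x)"
    and sets_law: "\<And>x. sets (law X x) = sets (events X)"
    and path_measurable: "\<And>t. path X t \<in> events X \<rightarrow>\<^sub>M borel_Delta"
    and law_measurable: "\<And>A. A \<in> sets (natural_filtration X \<infinity>) \<Longrightarrow>
      (\<lambda>x. emeasure (law X x) A) \<in> borel_measurable borel_Delta"
    and path_infinity: "\<And>\<omega>. \<omega> \<in> samples X \<Longrightarrow> path X \<infinity> \<omega> = None"
    and cemetery: "\<And>\<omega> s t. \<omega> \<in> samples X \<Longrightarrow> path X s \<omega> = None \<Longrightarrow> s \<le> t \<Longrightarrow> path X t \<omega> = None"
    and shift_space: "\<And>t \<omega>. \<omega> \<in> samples X \<Longrightarrow> shift X t \<omega> \<in> samples X"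
    and path_shift: "\<And>s t \<omega>. \<omega> \<in> samples X \<Longrightarrow> path X s (shift X t \<omega>) = path X (s + t) \<omega>"
    and normal: "\<And>x. AE \<omega> in law X x. path X 0 \<omega> = x"
    and right_continuous: "\<And>\<omega> t. \<omega> \<in> samples X \<Longrightarrow> t < \<infinity> \<Longrightarrow>
      limitin top_Delta (\<lambda>s. path X s \<omega>) (path X t \<omega>) (at_right t)"
    and filtration_right_continuous: "\<And>t. t < \<infinity> \<Longrightarrow>
      sets (augmented_filtration X t) = (\<Inter>u\<in>{t<..}. sets (augmented_filtration X u))"
    and strong_Markov: "\<And>\<nu> T s B. \<nu> \<in> initial_laws \<Longrightarrow>
      stopping_time (augmented_filtration X) T \<Longrightarrow> B \<in> sets borel_Delta \<Longrightarrow>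
      AE \<omega> in law_from X \<nu>.
        real_cond_exp (completion (law_from X \<nu>))
          (filtration.pre_sigma (samples X) (augmented_filtration X) T)
          (indicator {\<omega> \<in> samples X. path X (T \<omega> + s) \<omega> \<in> B}) \<omega>
        = measure (law X (path X (T \<omega>) \<omega>)) {\<omega>' \<in> samples X. path X s \<omega>' \<in> B}"
    and left_limits: "\<And>\<nu>. \<nu> \<in> initial_laws \<Longrightarrow>
      AE \<omega> in law_from X \<nu>. \<forall>t. 0 < t \<and> t < lifetime X \<omega> \<longrightarrow>
        (\<exists>y. limitin top_Delta (\<lambda>s. path X s \<omega>) (Some y) (at_left t))"
    and quasi_left_continuous: "\<And>\<nu> T. \<nu> \<in> initial_laws \<Longrightarrow>
      (\<And>n. stopping_time (augmented_filtration X) (T n)) \<Longrightarrow>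
      (\<And>\<omega>. \<omega> \<in> samples X \<Longrightarrow> incseq (\<lambda>n. T n \<omega>)) \<Longrightarrow>
      AE \<omega> in law_from X \<nu>. (SUP n. T n \<omega>) < lifetime X \<omega> \<longrightarrow>
        limitin top_Delta (\<lambda>n. path X (T n \<omega>) \<omega>) (path X (SUP n. T n \<omega>) \<omega>) sequentially"


section \<open>Duality and absolute continuity\<close>

definition transition_density ::
    "('w, 'a::topological_space) process \<Rightarrow> ('v, 'a) process \<Rightarrow> 'a measure
      \<Rightarrow> (real \<Rightarrow> 'a \<Rightarrow> 'a \<Rightarrow> ennreal) \<Rightarrow> bool" where
  "transition_density X Xh m p \<longleftrightarrow>
     (\<lambda>(t, x, y). p t x y) \<in> borel_measurable (restrict_space borel ({0<..} \<times> UNIV)) \<and>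
     (\<forall>t>0. \<forall>x. \<forall>E\<in>sets borel.
       emeasure (law X (Some x)) {\<omega> \<in> samples X. path X (ennreal t) \<omega> \<in> Some ` E}
         = (\<integral>\<^sup>+y\<in>E. p t x y \<partial>m)) \<and>
     (\<forall>t>0. \<forall>y. \<forall>E\<in>sets borel.
       emeasure (law Xh (Some y)) {\<omega> \<in> samples Xh. path Xh (ennreal t) \<omega> \<in> Some ` E}
         = (\<integral>\<^sup>+x\<in>E. p t x y \<partial>m)) \<and>
     (\<forall>s>0. \<forall>t>0. \<forall>x y. p (t + s) x y = (\<integral>\<^sup>+z. p t x z * p s z y \<partial>m))"

definition resolvent_density ::
    "(real \<Rightarrow> 'a \<Rightarrow> 'a \<Rightarrow> ennreal) \<Rightarrow> 'a \<Rightarrow> 'a \<Rightarrow> ennreal" where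
  "resolvent_density p x y = (\<integral>\<^sup>+t\<in>{0<..}. ennreal (exp (- t)) * p t x y \<partial>lborel)"

definition potential ::
    "(real \<Rightarrow> 'a \<Rightarrow> 'a \<Rightarrow> ennreal) \<Rightarrow> 'a measure \<Rightarrow> 'a \<Rightarrow> ennreal" where
  "potential p \<mu> x = (\<integral>\<^sup>+y. resolvent_density p x y \<partial>\<mu>)"


section \<open>Semipolar sets\<close>

definition hitting_time :: "('w, 'a) process \<Rightarrow> 'a set \<Rightarrow> 'w \<Rightarrow> ennreal" where
  "hitting_time X E \<omega> = Inf {t. 0 < t \<and> t < \<infinity> \<and> path X t \<omega> \<in> Some ` E}"

definition nearly_Borel :: "('w, 'a::topological_space) process \<Rightarrow> 'a set \<Rightarrow> bool" where
  "nearly_Borel X B \<longleftrightarrow> (\<forall>\<nu>\<in>initial_laws. \<exists>B1\<in>sets borel. \<exists>B2\<in>sets borel.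
     B1 \<subseteq> B \<and> B \<subseteq> B2 \<and> (AE \<omega> in law_from X \<nu>. \<forall>t. path X t \<omega> \<notin> Some ` (B2 - B1)))"

definition thin :: "('w, 'a::topological_space) process \<Rightarrow> 'a set \<Rightarrow> bool" where
  "thin X A \<longleftrightarrow> (\<exists>B. nearly_Borel X B \<and> A \<subseteq> B \<and>
     (\<forall>x. AE \<omega> in law X (Some x). hitting_time X B \<omega> \<noteq> 0))"

definition semipolar :: "('w, 'a::topological_space) process \<Rightarrow> 'a set \<Rightarrow> bool" where
  "semipolar X A \<longleftrightarrow> (\<exists>B :: nat \<Rightarrow> 'a set. (\<forall>i. thin X (B i)) \<and> A \<subseteq> (\<Union>i. B i))"

text \<open>Semipolar sets need not be Borel, hence the completion.\<close>

definition charges_no_semipolar ::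
    "('w, 'a::topological_space) process \<Rightarrow> 'a measure \<Rightarrow> bool" where
  "charges_no_semipolar X \<mu> \<longleftrightarrow> (\<forall>A. semipolar X A \<longrightarrow> A \<in> null_sets (completion \<mu>))"


section \<open>Measures on the state space\<close>

text \<open>
  On a locally compact separable metrizable space, a Borel measure that is finite on compact
  sets is automatically regular.
\<close>

definition Radon_measure :: "'a::topological_space measure \<Rightarrow> bool" where
  "Radon_measure \<mu> \<longleftrightarrow> sets \<mu> = sets borel \<and> (\<forall>K. compact K \<longrightarrow> emeasure \<mu> K < \<infinity>)"

definition vague_limit ::
    "(nat \<Rightarrow> 'a::topological_space measure) \<Rightarrow> 'a measure \<Rightarrow> bool" where
  "vague_limit \<mu>s \<mu> \<longleftrightarrow>
     (\<forall>f :: 'a \<Rightarrow> real. continuous_on UNIV f \<and> compact (closure {x. f x \<noteq> 0}) \<longrightarrow>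
       (\<lambda>n. integral\<^sup>L (\<mu>s n) f) \<longlonglongrightarrow> integral\<^sup>L \<mu> f)"

definition restr :: "'a measure \<Rightarrow> 'a set \<Rightarrow> 'a measure" where
  "restr \<mu> E = density \<mu> (indicator E)"

definition add_measure :: "'a measure \<Rightarrow> 'a measure \<Rightarrow> 'a measure" where
  "add_measure \<mu> \<nu> = measure_of (space \<mu>) (sets \<mu>) (\<lambda>A. emeasure \<mu> A + emeasure \<nu> A)"

lemma emeasure_add_measure:
  assumes "sets \<nu> = sets \<mu>" "A \<in> sets \<mu>"
  shows "emeasure (add_measure \<mu> \<nu>) A = emeasure \<mu> A + emeasure \<nu> A"
proof (rule emeasure_measure_of[OF add_measure_def])
  show "sets \<mu> \<subseteq> Pow (space \<mu>)" by (rule sets.space_closed)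
  show "A \<in> sets (add_measure \<mu> \<nu>)" using assms(2) by (simp add: add_measure_def)
  show "positive (sets (add_measure \<mu> \<nu>)) (\<lambda>A. emeasure \<mu> A + emeasure \<nu> A)"
    by (simp add: positive_def)
  show "countably_additive (sets (add_measure \<mu> \<nu>)) (\<lambda>A. emeasure \<mu> A + emeasure \<nu> A)"
  proof (rule countably_additiveI)
    fix B :: "nat \<Rightarrow> 'a set"
    assume "range B \<subseteq> sets (add_measure \<mu> \<nu>)" and "disjoint_family B"
    moreover from this have "range B \<subseteq> sets \<mu>" by (simp add: add_measure_def)
    ultimately show "(\<Sum>i. emeasure \<mu> (B i) + emeasure \<nu> (B i)) = emeasure \<mu> (\<Union>i. B i) + emeasure \<nu> (\<Union>i. B i)"
      using assms(1) by (simp add: suminf_add[symmetric] suminf_emeasure)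
  qed
qed

definition S00 ::
    "('w, 'a::topological_space) process \<Rightarrow> (real \<Rightarrow> 'a \<Rightarrow> 'a \<Rightarrow> ennreal) \<Rightarrow> 'a measure set" where
  "S00 X p = {\<mu>. sets \<mu> = sets borel \<and> finite_measure \<mu> \<and> charges_no_semipolar X \<mu> \<and>
     (SUP x. potential p \<mu> x) < \<infinity>}"

definition Linfty_norm :: "'a measure \<Rightarrow> ('a \<Rightarrow> ereal) \<Rightarrow> ereal" where
  "Linfty_norm \<nu> f = Inf {ereal C |C. 0 < C \<and> (AE x in \<nu>. \<bar>f x\<bar> \<le> ereal C)}"

end

theory Submission
  imports Defs
begin

text \<open>
  Duality enters only through the weak convergence \<open>p\<^sub>s(z, y) m(dz) \<longrightarrow> \<delta>\<^sub>y\<close> as \<open>s \<longrightarrow> 0\<close>, a consequence of the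
  right continuity of the dual process. It yields a maximum principle without hitting times or
  additive functionals: for \<open>g\<close> vanishing off an open set \<open>U\<close>, the sums \<open>\<Sum>\<^sub>j P\<^bsub>j\<delta>\<^esub> g\<close> are bounded by their
  supremum over \<open>U\<close>, and with \<open>g = 1\<^sub>U \<integral>\<^sub>0\<^sup>\<delta> P\<^sub>s\<nu> ds\<close> they approximate \<open>\<integral>\<^sub>0\<^sup>t P\<^sub>s\<nu> ds\<close> from below as \<open>\<delta> \<longrightarrow> 0\<close> when \<open>\<nu>\<close>
  is carried by \<open>U\<close>. Hence the bound (B3) on a compact set extends to the whole space, and the semigroup
  property turns it into bounds on the potentials and on the tails of their time integrals, uniform
  in \<open>n\<close>. On a bounded time interval away from \<open>0\<close> the kernel is continuous, so choosing the \<open>V\<^sub>k\<close> with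
  \<open>\<mu>\<close>-null boundary gives uniform convergence there.
\<close>

section \<open>Sub-Markovian densities\<close>

lemma nn_integral_Ioc_split:
  fixes f :: "real \<Rightarrow> ennreal"
  assumes [measurable]: "f \<in> borel_measurable borel" and "a \<le> b" "b \<le> c"
  shows "(\<integral>\<^sup>+s\<in>{a<..c}. f s \<partial>lborel) = (\<integral>\<^sup>+s\<in>{a<..b}. f s \<partial>lborel) + (\<integral>\<^sup>+s\<in>{b<..c}. f s \<partial>lborel)"
  using assms(2,3) by (subst nn_integral_add[symmetric]) (auto intro!: nn_integral_cong simp: indicator_def)

lemma nn_integral_Ioc_shift:
  fixes f :: "real \<Rightarrow> ennreal"
  assumes [measurable]: "f \<in> borel_measurable borel"
  shows "(\<integral>\<^sup>+s\<in>{a<..b}. f (c + s) \<partial>lborel) = (\<integral>\<^sup>+s\<in>{c + a<..c + b}. f s \<partial>lborel)"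
  by (subst nn_integral_real_affine[where c = 1 and t = c])
     (auto intro!: nn_integral_cong simp: indicator_def)

text \<open>\<open>grid_point \<delta> u\<close> is strictly below \<open>u\<close>, so that densities are only evaluated at positive times.\<close>

definition grid_point :: "real \<Rightarrow> real \<Rightarrow> real" where
  "grid_point \<delta> u = (of_int \<lceil>u / \<delta>\<rceil> - 1) * \<delta>"

lemma grid_point_measurable [measurable]: "grid_point \<delta> \<in> borel_measurable borel"
  unfolding grid_point_def[abs_def] by measurable

lemma grid_point_eq:
  assumes "0 < \<delta>" "u \<in> {real j * \<delta><..real j * \<delta> + \<delta>}"
  shows "grid_point \<delta> u = real j * \<delta>"
proof -
  have "\<lceil>u / \<delta>\<rceil> = int j + 1"
    using assms by (intro ceiling_unique) (auto simp: field_simps)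
  then show ?thesis by (simp add: grid_point_def)
qed

lemma grid_point_bounds:
  assumes "0 < \<delta>"
  shows "grid_point \<delta> u < u" "u \<le> grid_point \<delta> u + \<delta>"
proof -
  have "of_int \<lceil>u / \<delta>\<rceil> - 1 < u / \<delta>" by linarith
  then show "grid_point \<delta> u < u"
    using assms by (simp add: grid_point_def pos_less_divide_eq)
  have "u / \<delta> \<le> of_int \<lceil>u / \<delta>\<rceil>" by linarith
  then have "u / \<delta> * \<delta> \<le> of_int \<lceil>u / \<delta>\<rceil> * \<delta>"
    using assms by (intro mult_right_mono) auto
  then show "u \<le> grid_point \<delta> u + \<delta>"
    using assms by (simp add: grid_point_def algebra_simps)
qed

text \<open>\<open>p_measurable\<close> covers all real times, so a density given for positive times
  only is extended first. \<open>concentration\<close> integrates over the first argument with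
  \<open>y\<close> fixed: for a transition density this is the mass that the dual process started at
  \<open>y\<close> gives to \<open>W\<close> at time \<open>s n\<close>.\<close>

locale submarkov_density = sigma_finite_measure m
  for m :: "'a::{metric_space, second_countable_topology} measure" +
  fixes p :: "real \<Rightarrow> 'a \<Rightarrow> 'a \<Rightarrow> ennreal"
  assumes sets_m [measurable_cong, simp]: "sets m = sets borel"
    and p_measurable: "(\<lambda>(t, x, y). p t x y) \<in> borel_measurable (borel \<Otimes>\<^sub>M borel \<Otimes>\<^sub>M borel)"
    and chapman_kolmogorov: "\<And>s t x y. 0 < s \<Longrightarrow> 0 < t \<Longrightarrow> p (s + t) x y = (\<integral>\<^sup>+z. p s x z * p t z y \<partial>m)"
    and sub_markov: "\<And>t x. 0 < t \<Longrightarrow> (\<integral>\<^sup>+z. p t x z \<partial>m) \<le> 1"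
    and concentration: "\<And>W y s. open W \<Longrightarrow> y \<in> W \<Longrightarrow> (\<And>n. 0 < s n) \<Longrightarrow> s \<longlonglongrightarrow> 0 \<Longrightarrow>
      (\<lambda>n::nat. \<integral>\<^sup>+z\<in>W. p (s n) z y \<partial>m) \<longlonglongrightarrow> 1"
    and p_continuous: "continuous_on ({0<..} \<times> UNIV) (\<lambda>(t, x, y). p t x y)"
    and p_finite: "\<And>t x y. 0 < t \<Longrightarrow> p t x y < \<infinity>"
begin

lemma p_measurable' [measurable (raw)]:
  assumes "f \<in> borel_measurable M" "g \<in> borel_measurable M" "h \<in> borel_measurable M"
  shows "(\<lambda>w. p (f w) (g w) (h w)) \<in> borel_measurable M"
proof -
  have "(\<lambda>w. (f w, g w, h w)) \<in> M \<rightarrow>\<^sub>M borel \<Otimes>\<^sub>M borel \<Otimes>\<^sub>M borel"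
    using assms by measurable
  from measurable_compose[OF this p_measurable] show ?thesis by simp
qed

text \<open>The function \<open>P_s \<nu>\<close>; for a transition density it is the density with
  respect to \<open>m\<close> of \<open>\<nu>\<close> transported for time \<open>s\<close> by the
  dual semigroup.\<close>

definition flow :: "'a measure \<Rightarrow> real \<Rightarrow> 'a \<Rightarrow> ennreal" where
  "flow \<nu> s x = (\<integral>\<^sup>+y. p s x y \<partial>\<nu>)"

lemma smear_le:
  assumes "0 < t" "\<And>z. f z \<le> C"
  shows "(\<integral>\<^sup>+z. p t x z * f z \<partial>m) \<le> C"
proof -
  have "(\<integral>\<^sup>+z. p t x z * f z \<partial>m) \<le> (\<integral>\<^sup>+z. p t x z * C \<partial>m)"
    using assms by (intro nn_integral_mono mult_left_mono) auto
  also have "\<dots> = (\<integral>\<^sup>+z. p t x z \<partial>m) * C"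
    by (rule nn_integral_multc) measurable
  also have "\<dots> \<le> 1 * C"
    by (intro mult_right_mono sub_markov assms) auto
  finally show ?thesis by simp
qed

lemma smear_smear:
  assumes [measurable]: "f \<in> borel_measurable borel" and "0 < s" "0 < t"
  shows "(\<integral>\<^sup>+z. p s x z * (\<integral>\<^sup>+w. p t z w * f w \<partial>m) \<partial>m) = (\<integral>\<^sup>+w. p (s + t) x w * f w \<partial>m)"
proof -
  interpret pair_sigma_finite m m by unfold_locales
  have "(\<integral>\<^sup>+z. p s x z * (\<integral>\<^sup>+w. p t z w * f w \<partial>m) \<partial>m) = (\<integral>\<^sup>+z. \<integral>\<^sup>+w. p s x z * (p t z w * f w) \<partial>m \<partial>m)"
    by (subst nn_integral_cmult) (auto, measurable)
  also have "\<dots> = (\<integral>\<^sup>+w. \<integral>\<^sup>+z. p s x z * (p t z w * f w) \<partial>m \<partial>m)"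
    by (rule Fubini') measurable
  also have "\<dots> = (\<integral>\<^sup>+w. (\<integral>\<^sup>+z. p s x z * p t z w \<partial>m) * f w \<partial>m)"
    by (subst nn_integral_multc[symmetric]) (auto simp: mult.assoc, measurable)
  finally show ?thesis using assms by (simp add: chapman_kolmogorov)
qed

end

locale density_measure = submarkov_density m p + \<nu>: finite_measure \<nu>
  for m :: "'a::{metric_space, second_countable_topology} measure" and p and \<nu> :: "'a measure" +
  assumes sets_nu [measurable_cong, simp]: "sets \<nu> = sets borel"
begin

lemma flow_measurable [measurable (raw)]:
  assumes [measurable]: "f \<in> borel_measurable M" "g \<in> borel_measurable M"
  shows "(\<lambda>w. flow \<nu> (f w) (g w)) \<in> borel_measurable M"
  unfolding flow_def by measurable

lemma flow_semigroup:
  assumes "0 < r" "0 < s"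
  shows "flow \<nu> (r + s) x = (\<integral>\<^sup>+z. p r x z * flow \<nu> s z \<partial>m)"
proof -
  interpret pair_sigma_finite m \<nu> by unfold_locales
  have "(\<integral>\<^sup>+z. p r x z * flow \<nu> s z \<partial>m) = (\<integral>\<^sup>+z. \<integral>\<^sup>+y. p r x z * p s z y \<partial>\<nu> \<partial>m)"
    unfolding flow_def by (subst nn_integral_cmult) (auto, measurable)
  also have "\<dots> = (\<integral>\<^sup>+y. \<integral>\<^sup>+z. p r x z * p s z y \<partial>m \<partial>\<nu>)"
    by (rule Fubini'[symmetric]) measurable
  finally show ?thesis using assms by (simp add: chapman_kolmogorov flow_def)
qed

text \<open>Tonelli brings the kernel inside the time integral, where the semigroup property turns
  it into a translation of time by \<open>r\<close>. With \<open>0 \<le> a\<close> the half-open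
  window contains positive times only.\<close>

lemma smear_flow:
  assumes "0 < r" "0 \<le> a"
  shows "(\<integral>\<^sup>+z. p r x z * (\<integral>\<^sup>+s\<in>{a<..b}. flow \<nu> s z \<partial>lborel) \<partial>m)
    = (\<integral>\<^sup>+s\<in>{r + a<..r + b}. flow \<nu> s x \<partial>lborel)"
proof -
  interpret pair_sigma_finite m lborel by unfold_locales
  have "(\<integral>\<^sup>+z. p r x z * (\<integral>\<^sup>+s\<in>{a<..b}. flow \<nu> s z \<partial>lborel) \<partial>m)
    = (\<integral>\<^sup>+z. \<integral>\<^sup>+s. p r x z * (flow \<nu> s z * indicator {a<..b} s) \<partial>lborel \<partial>m)"
    by (subst nn_integral_cmult) (auto, measurable)
  also have "\<dots> = (\<integral>\<^sup>+s. \<integral>\<^sup>+z. p r x z * (flow \<nu> s z * indicator {a<..b} s) \<partial>m \<partial>lborel)"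
    by (rule Fubini'[symmetric]) measurable
  also have "\<dots> = (\<integral>\<^sup>+s\<in>{a<..b}. (\<integral>\<^sup>+z. p r x z * flow \<nu> s z \<partial>m) \<partial>lborel)"
    by (subst nn_integral_multc[symmetric]) (auto simp: mult.assoc, measurable)
  also have "\<dots> = (\<integral>\<^sup>+s\<in>{a<..b}. flow \<nu> (r + s) x \<partial>lborel)"
    using assms by (intro nn_integral_cong) (auto simp: indicator_def flow_semigroup)
  also have "\<dots> = (\<integral>\<^sup>+s\<in>{r + a<..r + b}. flow \<nu> s x \<partial>lborel)"
    by (rule nn_integral_Ioc_shift) measurable
  finally show ?thesis .
qed

end

section \<open>The maximum principle\<close>

context submarkov_density begin

text \<open>Joint continuity keeps \<open>p (r n) x z\<close> above any \<open>c < p u x y\<close>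
  for \<open>z\<close> near \<open>y\<close> and large \<open>n\<close>, and
  \<open>p (s n) z y\<close> concentrates its mass on that neighbourhood of \<open>y\<close>. The
  rest of \<open>U\<close> contributes a nonnegative amount and is discarded, hence a bound on the
  lower limit only.\<close>

lemma le_liminf_two_step:
  assumes "open U" "y \<in> U" "r \<longlonglongrightarrow> u" "0 < u" "\<And>n::nat. 0 < s n" "s \<longlonglongrightarrow> 0"
  shows "p u x y \<le> liminf (\<lambda>n. \<integral>\<^sup>+z\<in>U. p (r n) x z * p (s n) z y \<partial>m)"
proof (rule dense_le)
  fix c assume c: "c < p u x y"
  have "continuous_on ({0<..} \<times> UNIV) ((\<lambda>(t, x, y). p t x y) \<circ> (\<lambda>(t, z). (t, x, z)))"
    by (intro continuous_on_compose continuous_on_subset[OF p_continuous])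
       (auto intro!: continuous_intros simp: split_beta)
  then have "isCont ((\<lambda>(t, x, y). p t x y) \<circ> (\<lambda>(t, z). (t, x, z))) (u, y)"
    using assms(4) by (subst (asm) continuous_on_eq_continuous_at) (auto intro!: open_Times)
  then have "(((\<lambda>(t, x, y). p t x y) \<circ> (\<lambda>(t, z). (t, x, z))) \<longlongrightarrow>
      ((\<lambda>(t, x, y). p t x y) \<circ> (\<lambda>(t, z). (t, x, z))) (u, y)) (nhds (u, y))"
    unfolding isCont_def tendsto_at_iff_tendsto_nhds .
  then have "eventually (\<lambda>w. c < ((\<lambda>(t, x, y). p t x y) \<circ> (\<lambda>(t, z). (t, x, z))) w) (nhds u \<times>\<^sub>F nhds y)"
    using c by (auto simp: nhds_prod dest: order_tendstoD)
  then obtain Pf Pg where Pf: "eventually Pf (nhds u)" and Pg: "eventually Pg (nhds y)"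
    and P: "\<And>t z. Pf t \<Longrightarrow> Pg z \<Longrightarrow> c < p t x z"
    unfolding eventually_prod_filter by auto
  from Pg obtain W where W: "open W" "y \<in> W" "\<And>z. z \<in> W \<Longrightarrow> Pg z"
    unfolding eventually_nhds by auto
  define W' where "W' = W \<inter> U"
  have W': "open W'" "y \<in> W'" "W' \<subseteq> U" using W assms unfolding W'_def by auto
  have [measurable]: "W' \<in> sets borel" "U \<in> sets borel" using W' assms by auto
  have ev: "eventually (\<lambda>n. c * (\<integral>\<^sup>+z\<in>W'. p (s n) z y \<partial>m) \<le> (\<integral>\<^sup>+z\<in>U. p (r n) x z * p (s n) z y \<partial>m)) sequentially"
    using filterlim_iff[THEN iffD1, OF assms(3), rule_format, OF Pf]
  proof eventually_elim
    case (elim n)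
    have "c * (\<integral>\<^sup>+z\<in>W'. p (s n) z y \<partial>m) = (\<integral>\<^sup>+z. c * (p (s n) z y * indicator W' z) \<partial>m)"
      by (rule nn_integral_cmult[symmetric]) measurable
    also have "\<dots> \<le> (\<integral>\<^sup>+z\<in>U. p (r n) x z * p (s n) z y \<partial>m)"
      using P[OF elim] W W' by (intro nn_integral_mono) (auto simp: indicator_def W'_def intro!: mult_right_mono[OF less_imp_le])
    finally show ?case .
  qed
  \<comment> \<open>\<open>c\<close> is finite, being strictly below \<open>p u x y\<close>, so the
    limit of the masses may be multiplied by it.\<close>
  have "(\<lambda>n. c * (\<integral>\<^sup>+z\<in>W'. p (s n) z y \<partial>m)) \<longlonglongrightarrow> c * 1"
    using c by (intro ennreal_tendsto_cmult concentration W' assms) (auto intro: less_le_trans)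
  then have "c = liminf (\<lambda>n. c * (\<integral>\<^sup>+z\<in>W'. p (s n) z y \<partial>m))"
    by (simp add: lim_imp_Liminf)
  also have "\<dots> \<le> liminf (\<lambda>n. \<integral>\<^sup>+z\<in>U. p (r n) x z * p (s n) z y \<partial>m)"
    by (rule Liminf_mono[OF ev])
  finally show "c \<le> \<dots>" .
qed

text \<open>The partial sum of \<open>P_{j \<delta>} g\<close> over \<open>j = 0, ..., J\<close>, in
  Horner form: each stage peels off one application of \<open>P_\<delta>\<close>, which is what the
  inductions on \<open>J\<close> use.\<close>

primrec partial_potential :: "real \<Rightarrow> ('a \<Rightarrow> ennreal) \<Rightarrow> nat \<Rightarrow> 'a \<Rightarrow> ennreal" where
  "partial_potential \<delta> g 0 = g"
| "partial_potential \<delta> g (Suc J) = (\<lambda>x. g x + (\<integral>\<^sup>+z. p \<delta> x z * partial_potential \<delta> g J z \<partial>m))"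

text \<open>Applying \<open>P_\<delta>\<close> raises the time of every summand by
  \<open>\<delta>\<close>. The term for \<open>j = 0\<close> stands apart as \<open>g x\<close>,
  because time 0 has no kernel.\<close>

lemma partial_potential_eq:
  assumes [measurable]: "g \<in> borel_measurable borel" and \<delta>: "0 < \<delta>"
  shows "partial_potential \<delta> g J x = g x + (\<Sum>j<J. \<integral>\<^sup>+z. p (real (Suc j) * \<delta>) x z * g z \<partial>m)"
proof (induction J arbitrary: x)
  case (Suc J)
  have "(\<integral>\<^sup>+z. p \<delta> x z * partial_potential \<delta> g J z \<partial>m)
      = (\<integral>\<^sup>+z. p \<delta> x z * g z + (\<Sum>j<J. p \<delta> x z * (\<integral>\<^sup>+w. p (real (Suc j) * \<delta>) z w * g w \<partial>m)) \<partial>m)"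
    unfolding Suc.IH by (simp add: distrib_left sum_distrib_left)
  also have "\<dots> = (\<integral>\<^sup>+z. p \<delta> x z * g z \<partial>m)
      + (\<Sum>j<J. \<integral>\<^sup>+z. p \<delta> x z * (\<integral>\<^sup>+w. p (real (Suc j) * \<delta>) z w * g w \<partial>m) \<partial>m)"
    by (subst nn_integral_add, measurable, subst nn_integral_sum, measurable)
  also have "\<dots> = (\<Sum>j<Suc J. \<integral>\<^sup>+z. p (real (Suc j) * \<delta>) x z * g z \<partial>m)"
  proof -
    have "(\<integral>\<^sup>+z. p \<delta> x z * (\<integral>\<^sup>+w. p (real (Suc j) * \<delta>) z w * g w \<partial>m) \<partial>m)
      = (\<integral>\<^sup>+z. p (real (Suc (Suc j)) * \<delta>) x z * g z \<partial>m)" for j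
      using \<delta> by (subst smear_smear) (auto simp: algebra_simps add_pos_nonneg)
    then show ?thesis by (subst sum.lessThan_Suc_shift) simp
  qed
  finally show ?case by simp
qed simp

text \<open>Off \<open>U\<close> the source \<open>g\<close> vanishes, so the value at stage
  \<open>Suc J\<close> is an average, of total mass at most one, of the values at stage
  \<open>J\<close>, which are bounded by \<open>C\<close> everywhere by induction. This is why the
  bound on \<open>U\<close> is required at every stage up to \<open>J\<close>.\<close>

lemma partial_potential_maximum:
  assumes "0 < \<delta>" "\<And>x. x \<notin> U \<Longrightarrow> g x = 0"
    and "\<And>x j. x \<in> U \<Longrightarrow> j \<le> J \<Longrightarrow> partial_potential \<delta> g j x \<le> C"
  shows "partial_potential \<delta> g J x \<le> C"
  using assms(3)
proof (induction J arbitrary: x)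
  case 0
  then show ?case using assms(2)[of x] by (cases "x \<in> U") auto
next
  case (Suc J)
  show ?case
  proof (cases "x \<in> U")
    case False
    then show ?thesis using assms(1,2) Suc by (auto intro!: smear_le)
  qed (use Suc in blast)
qed

end

section \<open>Discretised time integrals of the flow\<close>

context density_measure begin

text \<open>The value at \<open>x\<close> of \<open>P_r (1_U P_s \<nu>)\<close>, with the integral
  over \<open>\<nu>\<close> outermost so that Fatou's lemma can be applied in
  \<open>y\<close>.\<close>

definition two_step :: "'a set \<Rightarrow> real \<Rightarrow> real \<Rightarrow> 'a \<Rightarrow> ennreal" where
  "two_step U r s x = (\<integral>\<^sup>+y. (\<integral>\<^sup>+z\<in>U. p r x z * p s z y \<partial>m) \<partial>\<nu>)"

lemma two_step_measurable [measurable]: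
  assumes [measurable]: "U \<in> sets borel"
  shows "(\<lambda>(r, s). two_step U r s x) \<in> borel_measurable (borel \<Otimes>\<^sub>M borel)"
  unfolding two_step_def by measurable

lemma smear_truncated_flow:
  assumes [measurable]: "U \<in> sets borel"
  shows "(\<integral>\<^sup>+z. p r x z * (indicator U z * (\<integral>\<^sup>+s\<in>{a<..b}. flow \<nu> s z \<partial>lborel)) \<partial>m)
    = (\<integral>\<^sup>+s\<in>{a<..b}. two_step U r s x \<partial>lborel)"
proof -
  interpret ml: pair_sigma_finite m lborel by unfold_locales
  interpret mn: pair_sigma_finite m \<nu> by unfold_locales
  have "(\<integral>\<^sup>+z. p r x z * (indicator U z * (\<integral>\<^sup>+s\<in>{a<..b}. flow \<nu> s z \<partial>lborel)) \<partial>m)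
    = (\<integral>\<^sup>+z. \<integral>\<^sup>+s. p r x z * indicator U z * (flow \<nu> s z * indicator {a<..b} s) \<partial>lborel \<partial>m)"
    by (subst nn_integral_cmult) (auto simp: mult.assoc, measurable)
  also have "\<dots> = (\<integral>\<^sup>+s. \<integral>\<^sup>+z. p r x z * indicator U z * (flow \<nu> s z * indicator {a<..b} s) \<partial>m \<partial>lborel)"
    by (rule ml.Fubini'[symmetric]) measurable
  also have "\<dots> = (\<integral>\<^sup>+s\<in>{a<..b}. (\<integral>\<^sup>+z. p r x z * indicator U z * flow \<nu> s z \<partial>m) \<partial>lborel)"
    by (subst nn_integral_multc[symmetric]) (auto simp: mult.assoc, measurable)
  also have "\<dots> = (\<integral>\<^sup>+s\<in>{a<..b}. two_step U r s x \<partial>lborel)"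
  proof -
    have "(\<integral>\<^sup>+z. p r x z * indicator U z * flow \<nu> s z \<partial>m) = two_step U r s x" for s
    proof -
    have "(\<integral>\<^sup>+z. p r x z * indicator U z * flow \<nu> s z \<partial>m)
      = (\<integral>\<^sup>+z. \<integral>\<^sup>+y. p r x z * indicator U z * p s z y \<partial>\<nu> \<partial>m)"
      unfolding flow_def by (subst nn_integral_cmult) (auto, measurable)
    also have "\<dots> = (\<integral>\<^sup>+y. \<integral>\<^sup>+z. p r x z * indicator U z * p s z y \<partial>m \<partial>\<nu>)"
      by (rule mn.Fubini'[symmetric]) measurable
    finally show ?thesis unfolding two_step_def by (simp add: mult_ac)
    qed
    then show ?thesis by simp
  qed
  finally show ?thesis .
qed

text \<open>Dropping the indicator can only increase the sum, and then the windows
  \<open>(0, \<delta>]\<close>, \<open>(\<delta>, 2 \<delta>]\<close>, ... produced by successive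
  applications of the kernel fit together. Stage \<open>J\<close> has \<open>Suc J\<close>
  windows.\<close>

lemma partial_potential_le:
  assumes "0 < \<delta>"
  shows "partial_potential \<delta> (\<lambda>z. indicator U z * (\<integral>\<^sup>+s\<in>{0<..\<delta>}. flow \<nu> s z \<partial>lborel)) J x
    \<le> (\<integral>\<^sup>+s\<in>{0<..real (Suc J) * \<delta>}. flow \<nu> s x \<partial>lborel)"
proof (induction J arbitrary: x)
  case 0
  then show ?case by (auto simp: indicator_def)
next
  case (Suc J)
  let ?g = "\<lambda>z. indicator U z * (\<integral>\<^sup>+s\<in>{0<..\<delta>}. flow \<nu> s z \<partial>lborel)"
  have "partial_potential \<delta> ?g (Suc J) x = ?g x + (\<integral>\<^sup>+z. p \<delta> x z * partial_potential \<delta> ?g J z \<partial>m)"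
    by simp
  also have "\<dots> \<le> (\<integral>\<^sup>+s\<in>{0<..\<delta>}. flow \<nu> s x \<partial>lborel)
      + (\<integral>\<^sup>+z. p \<delta> x z * (\<integral>\<^sup>+s\<in>{0<..real (Suc J) * \<delta>}. flow \<nu> s z \<partial>lborel) \<partial>m)"
    by (intro add_mono nn_integral_mono mult_left_mono Suc.IH) (auto simp: indicator_def)
  also have "\<dots> = (\<integral>\<^sup>+s\<in>{0<..\<delta>}. flow \<nu> s x \<partial>lborel)
      + (\<integral>\<^sup>+s\<in>{\<delta><..real (Suc (Suc J)) * \<delta>}. flow \<nu> s x \<partial>lborel)"
    using assms by (subst smear_flow) (auto simp: algebra_simps)
  also have "\<dots> = (\<integral>\<^sup>+s\<in>{0<..real (Suc (Suc J)) * \<delta>}. flow \<nu> s x \<partial>lborel)"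
    using assms by (subst nn_integral_Ioc_split[symmetric]) (auto simp: algebra_simps)
  finally show ?case .
qed

text \<open>In the summand of index \<open>j\<close>, substitute
  \<open>u = real (Suc j) * \<delta> + s\<close>: the grid point of \<open>u\<close> is the time of
  the first kernel and the remainder that of the second. The integral starts at
  \<open>\<delta>\<close> because the sum leaves out the source term, which has no first
  kernel.\<close>

lemma sum_two_step_eq:
  assumes [measurable]: "U \<in> sets borel" and \<delta>: "0 < \<delta>"
  shows "(\<Sum>j<J. \<integral>\<^sup>+s\<in>{0<..\<delta>}. two_step U (real (Suc j) * \<delta>) s x \<partial>lborel)
    = (\<integral>\<^sup>+u\<in>{\<delta><..real (Suc J) * \<delta>}. two_step U (grid_point \<delta> u) (u - grid_point \<delta> u) x \<partial>lborel)"
proof (induction J)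
  case (Suc J)
  let ?f = "\<lambda>u. two_step U (grid_point \<delta> u) (u - grid_point \<delta> u) x"
  let ?r = "real (Suc J) * \<delta>"
  have "(\<integral>\<^sup>+s\<in>{0<..\<delta>}. two_step U ?r s x \<partial>lborel) = (\<integral>\<^sup>+s\<in>{0<..\<delta>}. two_step U ?r ((?r + s) - ?r) x \<partial>lborel)"
    by simp
  also have "\<dots> = (\<integral>\<^sup>+u\<in>{?r + 0<..?r + \<delta>}. two_step U ?r (u - ?r) x \<partial>lborel)"
    by (rule nn_integral_Ioc_shift) measurable
  also have "\<dots> = (\<integral>\<^sup>+u\<in>{?r<..?r + \<delta>}. ?f u \<partial>lborel)"
    using grid_point_eq[OF \<delta>, of _ "Suc J"] by (intro nn_integral_cong) (simp add: indicator_def)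
  finally have "(\<integral>\<^sup>+s\<in>{0<..\<delta>}. two_step U ?r s x \<partial>lborel) = (\<integral>\<^sup>+u\<in>{?r<..?r + \<delta>}. ?f u \<partial>lborel)" .
  moreover have "(\<integral>\<^sup>+u\<in>{\<delta><..?r + \<delta>}. ?f u \<partial>lborel)
    = (\<integral>\<^sup>+u\<in>{\<delta><..?r}. ?f u \<partial>lborel) + (\<integral>\<^sup>+u\<in>{?r<..?r + \<delta>}. ?f u \<partial>lborel)"
    using \<delta> by (intro nn_integral_Ioc_split) (auto simp: algebra_simps)
  ultimately show ?case using Suc by (simp add: algebra_simps)
qed simp

theorem maximum_principle:
  assumes "open U" and conc: "AE y in \<nu>. y \<in> U" and "0 < t"
    and C: "\<And>x. x \<in> U \<Longrightarrow> (\<integral>\<^sup>+s\<in>{0<..t}. flow \<nu> s x \<partial>lborel) \<le> C"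
  shows "(\<integral>\<^sup>+s\<in>{0<..t}. flow \<nu> s x \<partial>lborel) \<le> C"
proof -
  have [measurable]: "U \<in> sets borel" using assms by auto
  \<comment> \<open>\<open>Suc N\<close> windows of length \<open>d N\<close>, as many as stage
    \<open>N\<close> has terms, fill \<open>{0<..t}\<close> exactly.\<close>
  define d where "d N = t / real (Suc N)" for N
  have d: "0 < d N" "real (Suc N) * d N = t" for N
    using \<open>0 < t\<close> by (auto simp: d_def)
  have d0: "d \<longlonglongrightarrow> 0"
    unfolding d_def using lim_const_over_n[THEN LIMSEQ_Suc, of t] by simp
  define f where "f N u y = (\<integral>\<^sup>+z\<in>U. p (grid_point (d N) u) x z * p (u - grid_point (d N) u) z y \<partial>m)" for N u y
  have [measurable]: "(\<lambda>(u, y). f N u y) \<in> borel_measurable (borel \<Otimes>\<^sub>M borel)" for N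
    unfolding f_def by measurable
  \<comment> \<open>The first window is excluded because the source term of the partial potential is
    discarded; it disappears in the limit as \<open>d N\<close> tends to 0.\<close>
  have bound: "(\<integral>\<^sup>+u\<in>{0<..t}. (\<integral>\<^sup>+y. f N u y \<partial>\<nu>) * indicator {d N<..} u \<partial>lborel) \<le> C" for N
  proof -
    let ?g = "\<lambda>z. indicator U z * (\<integral>\<^sup>+s\<in>{0<..d N}. flow \<nu> s z \<partial>lborel)"
    have "(\<integral>\<^sup>+u\<in>{0<..t}. (\<integral>\<^sup>+y. f N u y \<partial>\<nu>) * indicator {d N<..} u \<partial>lborel)
       = (\<integral>\<^sup>+u\<in>{d N<..real (Suc N) * d N}. two_step U (grid_point (d N) u) (u - grid_point (d N) u) x \<partial>lborel)"
      using d[of N] unfolding two_step_def f_def by (intro nn_integral_cong) (auto simp: indicator_def)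
    also have "\<dots> \<le> partial_potential (d N) ?g N x"
      by (subst partial_potential_eq[OF _ d(1)], measurable)
         (simp add: smear_truncated_flow sum_two_step_eq[OF _ d(1)] del: of_nat_Suc)
    also have "\<dots> \<le> C"
    \<comment> \<open>At points of \<open>U\<close> every stage lies below the full time integral,
      which is at most \<open>C\<close> there; the discrete maximum principle carries this bound to
      \<open>x\<close>.\<close>
    proof (rule partial_potential_maximum[OF d(1)])
      fix y j assume y: "y \<in> U" and j: "j \<le> N"
      have "partial_potential (d N) ?g j y \<le> (\<integral>\<^sup>+s\<in>{0<..real (Suc j) * d N}. flow \<nu> s y \<partial>lborel)"
        by (rule partial_potential_le[OF d(1)])
      also have "\<dots> \<le> (\<integral>\<^sup>+s\<in>{0<..t}. flow \<nu> s y \<partial>lborel)"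
      proof -
        have "real (Suc j) * d N \<le> t" using j d(1)[of N] by (subst d(2)[of N, symmetric]) (intro mult_right_mono, auto)
        then show ?thesis by (intro nn_integral_mono) (auto simp: indicator_def)
      qed
      finally show "partial_potential (d N) ?g j y \<le> C" using C[OF y] by simp
    qed auto
    finally show ?thesis .
  qed
  \<comment> \<open>Fatou's lemma is used twice: in \<open>y\<close> for fixed \<open>u\<close>,
    then in \<open>u\<close>.\<close>
  have "(\<integral>\<^sup>+s\<in>{0<..t}. flow \<nu> s x \<partial>lborel)
    \<le> (\<integral>\<^sup>+u. liminf (\<lambda>N. (\<integral>\<^sup>+y. f N u y \<partial>\<nu>) * indicator {d N<..} u * indicator {0<..t} u) \<partial>lborel)"
  proof (intro nn_integral_mono)
    fix u :: real
    show "flow \<nu> u x * indicator {0<..t} u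
      \<le> liminf (\<lambda>N. (\<integral>\<^sup>+y. f N u y \<partial>\<nu>) * indicator {d N<..} u * indicator {0<..t} u)"
    proof (cases "0 < u \<and> u \<le> t")
      case True
      have r: "(\<lambda>N. grid_point (d N) u) \<longlonglongrightarrow> u"
      proof (rule tendsto_sandwich)
        show "(\<lambda>N. u - d N) \<longlonglongrightarrow> u" using tendsto_diff[OF tendsto_const[of u] d0] by simp
        show "eventually (\<lambda>N. u - d N \<le> grid_point (d N) u) sequentially"
          using grid_point_bounds(2)[OF d(1), of u] by (auto simp: algebra_simps)
        show "eventually (\<lambda>N. grid_point (d N) u \<le> u) sequentially"
          by (auto simp: less_imp_le grid_point_bounds(1)[OF d(1)])
      qed simp
      have s: "(\<lambda>N. u - grid_point (d N) u) \<longlonglongrightarrow> 0"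
        using tendsto_diff[OF tendsto_const[of u] r] by simp
      \<comment> \<open>As the mesh shrinks, the first time tends to \<open>u\<close> and the second
        decreases to 0 through positive values, so the two-step bound applies to almost every
        \<open>y\<close>, namely those in \<open>U\<close>.\<close>
      have "flow \<nu> u x \<le> (\<integral>\<^sup>+y. liminf (\<lambda>N. f N u y) \<partial>\<nu>)"
        unfolding flow_def
        using conc
      proof (intro nn_integral_mono_AE, eventually_elim)
        case (elim y)
        then show ?case unfolding f_def
          using True assms r s grid_point_bounds(1)[OF d(1)] by (intro le_liminf_two_step) auto
      qed
      also have "\<dots> \<le> liminf (\<lambda>N. \<integral>\<^sup>+y. f N u y \<partial>\<nu>)"
        by (rule nn_integral_liminf) measurable
      also have "\<dots> \<le> liminf (\<lambda>N. (\<integral>\<^sup>+y. f N u y \<partial>\<nu>) * indicator {d N<..} u * indicator {0<..t} u)"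
      proof (rule Liminf_mono)
        have "eventually (\<lambda>N. d N < u) sequentially"
          using True by (intro order_tendstoD[OF d0]) auto
        then show "eventually (\<lambda>N. (\<integral>\<^sup>+y. f N u y \<partial>\<nu>) \<le> (\<integral>\<^sup>+y. f N u y \<partial>\<nu>) * indicator {d N<..} u * indicator {0<..t} u) sequentially"
          by eventually_elim (use True in auto)
      qed
      finally show ?thesis using True by simp
    qed (auto simp: indicator_def)
  qed
  also have "\<dots> \<le> liminf (\<lambda>N. \<integral>\<^sup>+u. (\<integral>\<^sup>+y. f N u y \<partial>\<nu>) * indicator {d N<..} u * indicator {0<..t} u \<partial>lborel)"
    by (rule nn_integral_liminf) measurable
  also have "\<dots> \<le> liminf (\<lambda>N::nat. C)"
    by (intro Liminf_mono always_eventually allI bound)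
  finally show ?thesis by (simp add: Liminf_const)
qed

end

section \<open>Discounted time integrals\<close>

definition (in submarkov_density) discounted_flow :: "'a measure \<Rightarrow> real set \<Rightarrow> 'a \<Rightarrow> ennreal" where
  "discounted_flow \<nu> I x = (\<integral>\<^sup>+s\<in>I. ennreal (exp (- s)) * flow \<nu> s x \<partial>lborel)"

context density_measure begin

text \<open>\<open>P_b\<close> maps the time integral over \<open>{0<..t}\<close> to the one over
  the shifted window, and averaging preserves the bound. The case \<open>b = 0\<close> is separate,
  there being no kernel at time 0.\<close>

lemma flow_shift_le:
  assumes C: "\<And>x. (\<integral>\<^sup>+s\<in>{0<..t}. flow \<nu> s x \<partial>lborel) \<le> C" and "0 \<le> b"
  shows "(\<integral>\<^sup>+s\<in>{b<..b + t}. flow \<nu> s x \<partial>lborel) \<le> C"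
proof (cases "b = 0")
  case False
  then have "0 < b" using assms by simp
  then have "(\<integral>\<^sup>+s\<in>{b<..b + t}. flow \<nu> s x \<partial>lborel)
      = (\<integral>\<^sup>+z. p b x z * (\<integral>\<^sup>+s\<in>{0<..t}. flow \<nu> s z \<partial>lborel) \<partial>m)"
    by (subst smear_flow) auto
  also have "\<dots> \<le> C" by (intro smear_le C \<open>0 < b\<close>)
  finally show ?thesis .
qed (use C in simp)

lemma discounted_flow_Ioc_le:
  "discounted_flow \<nu> {a<..b} x \<le> ennreal (exp (- a)) * (\<integral>\<^sup>+s\<in>{a<..b}. flow \<nu> s x \<partial>lborel)"
proof -
  have "discounted_flow \<nu> {a<..b} x \<le> (\<integral>\<^sup>+s. ennreal (exp (- a)) * (flow \<nu> s x * indicator {a<..b} s) \<partial>lborel)"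
    unfolding discounted_flow_def
    by (intro nn_integral_mono) (auto simp: indicator_def intro!: mult_right_mono)
  also have "\<dots> = ennreal (exp (- a)) * (\<integral>\<^sup>+s\<in>{a<..b}. flow \<nu> s x \<partial>lborel)"
    by (rule nn_integral_cmult) measurable
  finally show ?thesis .
qed

lemma discounted_flow_split:
  assumes "a \<le> b"
  shows "discounted_flow \<nu> {a<..} x = discounted_flow \<nu> {a<..b} x + discounted_flow \<nu> {b<..} x"
  unfolding discounted_flow_def
  using assms by (subst nn_integral_add[symmetric]) (auto intro!: nn_integral_cong simp: indicator_def)

text \<open>Fatou's lemma for indicators of windows that are eventually one at each point of
  \<open>I\<close>. It serves both to reach unbounded times and to approach time 0.\<close>

lemma discounted_flow_exhaust_le:
  assumes "\<And>s. s \<in> I \<Longrightarrow> eventually (\<lambda>k. s \<in> {a k<..b k}) sequentially"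
    and c: "\<And>k::nat. discounted_flow \<nu> {a k<..b k} x \<le> c"
  shows "discounted_flow \<nu> I x \<le> c"
proof -
  let ?f = "\<lambda>s. ennreal (exp (- s)) * flow \<nu> s x"
  have "discounted_flow \<nu> I x \<le> (\<integral>\<^sup>+s. liminf (\<lambda>k. ?f s * indicator {a k<..b k} s) \<partial>lborel)"
    unfolding discounted_flow_def
  proof (intro nn_integral_mono)
    fix s :: real
    show "?f s * indicator I s \<le> liminf (\<lambda>k. ?f s * indicator {a k<..b k} s)"
    proof (cases "s \<in> I")
      case True
      show ?thesis
        by (rule Liminf_bounded, rule eventually_mono[OF assms(1)[OF True]]) (use True in auto)
    qed simp
  qed
  also have "\<dots> \<le> liminf (\<lambda>k. discounted_flow \<nu> {a k<..b k} x)"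
    unfolding discounted_flow_def by (rule nn_integral_liminf) measurable
  also have "\<dots> \<le> liminf (\<lambda>k::nat. c)"
    by (intro Liminf_mono always_eventually allI c)
  finally show ?thesis by (simp add: Liminf_const)
qed

text \<open>Cut \<open>{a<..}\<close> into consecutive windows of length \<open>t\<close>. On each
  the flow integrates to at most \<open>C\<close>, and the discount at the left ends gives a
  geometric series of ratio \<open>exp (- t)\<close>.\<close>

lemma discounted_flow_Ioi_le:
  assumes "0 < t" and C: "\<And>x. (\<integral>\<^sup>+s\<in>{0<..t}. flow \<nu> s x \<partial>lborel) \<le> C" and "0 \<le> a"
  shows "discounted_flow \<nu> {a<..} x \<le> ennreal (exp (- a)) * (C * ennreal (1 / (1 - exp (- t))))"
proof -
  have fin: "discounted_flow \<nu> {a<..a + real k * t} x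
      \<le> ennreal (exp (- a)) * (C * ennreal (\<Sum>i<k. exp (- t) ^ i))" for k
  proof (induction k)
    case 0
    then show ?case by (simp add: discounted_flow_def)
  next
    case (Suc k)
    let ?b = "a + real k * t"
    have b: "0 \<le> ?b" using assms by simp
    have "discounted_flow \<nu> {a<..?b + t} x = discounted_flow \<nu> {a<..?b} x + discounted_flow \<nu> {?b<..?b + t} x"
      unfolding discounted_flow_def using assms by (intro nn_integral_Ioc_split) auto
    also have "discounted_flow \<nu> {?b<..?b + t} x \<le> ennreal (exp (- ?b)) * C"
      by (intro order.trans[OF discounted_flow_Ioc_le] mult_left_mono flow_shift_le C b) auto
    also have "ennreal (exp (- ?b)) * C = ennreal (exp (- a)) * (C * ennreal (exp (- t) ^ k))"
      by (simp add: exp_add exp_diff exp_minus exp_of_nat2_mult field_simps flip: ennreal_mult mult.assoc)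
    also note Suc.IH
    finally show ?case
      by (simp add: algebra_simps sum_nonneg flip: distrib_left ennreal_plus)
  qed
  show ?thesis
  proof (rule discounted_flow_exhaust_le)
    fix s assume "s \<in> {a<..}"
    obtain K :: nat where K: "s - a \<le> real K * t"
      using reals_Archimedean3[OF \<open>0 < t\<close>] by (meson less_imp_le)
    show "eventually (\<lambda>k. s \<in> {a<..a + real k * t}) sequentially"
      using eventually_ge_at_top[of K]
    proof eventually_elim
      case (elim k)
      then have "real K * t \<le> real k * t" using \<open>0 < t\<close> by (intro mult_right_mono) auto
      then show ?case using K \<open>s \<in> {a<..}\<close> by auto
    qed
  next
    fix k
    have "(\<Sum>i<k. exp (- t) ^ i) \<le> 1 / (1 - exp (- t))"
      using \<open>0 < t\<close> by (simp add: sum_gp_strict divide_right_mono)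
    then show "discounted_flow \<nu> {a<..a + real k * t} x \<le> ennreal (exp (- a)) * (C * ennreal (1 / (1 - exp (- t))))"
      by (intro order.trans[OF fin] mult_left_mono ennreal_leI) auto
  qed
qed

lemma potential_eq_discounted_flow: "potential p \<nu> x = discounted_flow \<nu> {0<..} x"
proof -
  interpret pair_sigma_finite lborel \<nu> by unfold_locales
  have "potential p \<nu> x = (\<integral>\<^sup>+y. \<integral>\<^sup>+s. ennreal (exp (- s)) * p s x y * indicator {0<..} s \<partial>lborel \<partial>\<nu>)"
    by (simp add: potential_def resolvent_density_def)
  also have "\<dots> = (\<integral>\<^sup>+s. \<integral>\<^sup>+y. ennreal (exp (- s)) * p s x y * indicator {0<..} s \<partial>\<nu> \<partial>lborel)"
    by (rule Fubini') measurable
  also have "\<dots> = discounted_flow \<nu> {0<..} x"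
    unfolding discounted_flow_def flow_def
    by (subst nn_integral_cmult[symmetric], measurable, subst nn_integral_multc[symmetric], measurable)
  finally show ?thesis .
qed

end

section \<open>Vague convergence\<close>

lemma compact_cutoff_functions:
  fixes F U :: "'a::metric_space set"
  assumes "compact F" "open U" "F \<subseteq> U"
  obtains \<phi> :: "nat \<Rightarrow> 'a \<Rightarrow> real"
  where "\<And>j. continuous_on UNIV (\<phi> j)" "\<And>j y. 0 \<le> \<phi> j y" "\<And>j y. \<phi> j y \<le> 1"
    "\<And>j y. y \<in> F \<Longrightarrow> \<phi> j y = 1" "\<And>j y. y \<notin> U \<Longrightarrow> \<phi> j y = 0" "\<And>y. y \<notin> F \<Longrightarrow> (\<lambda>j. \<phi> j y) \<longlonglongrightarrow> 0"
proof (cases "F = {}")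
  case True
  \<comment> \<open>\<open>infdist y {}\<close> is 0 by convention, so the formula of the other case
    would give the constant 1 here.\<close>
  then show thesis by (intro that[of "\<lambda>_ _. 0"]) auto
next
  case False
  obtain e where e: "0 < e" "(\<Union>x\<in>F. ball x e) \<subseteq> U"
    using compact_subset_open_imp_ball_epsilon_subset[OF assms] by blast
  \<comment> \<open>Piecewise linear in the distance to \<open>F\<close>, with slope
    \<open>Suc j / e\<close>: already for \<open>j = 0\<close> the function vanishes at distance
    \<open>e\<close>, hence off \<open>U\<close>, and the support shrinks to \<open>F\<close> as
    \<open>j\<close> grows.\<close>
  define \<phi> where "\<phi> j y = max 0 (1 - real (Suc j) / e * infdist y F)" for j y
  show thesis
  proof (rule that)
    show "continuous_on UNIV (\<phi> j)" for j
      unfolding \<phi>_def by (intro continuous_intros)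
    show "0 \<le> \<phi> j y" "\<phi> j y \<le> 1" for j y
      using \<open>0 < e\<close> by (auto simp: \<phi>_def infdist_nonneg)
    show "\<phi> j y = 1" if "y \<in> F" for j y
      using that by (simp add: \<phi>_def)
    show "\<phi> j y = 0" if "y \<notin> U" for j y
    proof -
      have "e \<le> infdist y F"
        unfolding infdist_notempty[OF False]
      proof (intro cINF_greatest False)
        fix x assume "x \<in> F"
        with e that have "y \<notin> ball x e" by blast
        then show "e \<le> dist y x" by (simp add: dist_commute)
      qed
      then have "1 * e \<le> real (Suc j) * infdist y F"
        using \<open>0 < e\<close> by (intro mult_mono) auto
      then show ?thesis using \<open>0 < e\<close> by (simp add: \<phi>_def field_simps)
    qed
    show "(\<lambda>j. \<phi> j y) \<longlonglongrightarrow> 0" if "y \<notin> F" for y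
    proof -
      have pos: "0 < infdist y F"
        using that False compact_imp_closed[OF \<open>compact F\<close>]
        by (metis infdist_nonneg in_closed_iff_infdist_zero order_less_le)
      obtain J :: nat where J: "e < real J * infdist y F"
        using reals_Archimedean3[OF pos] by blast
      have "eventually (\<lambda>j. \<phi> j y = 0) sequentially"
        using eventually_ge_at_top[of J]
      proof eventually_elim
        case (elim j)
        then have "real J * infdist y F \<le> real (Suc j) * infdist y F" using pos by (intro mult_right_mono) auto
        with J show ?case using \<open>0 < e\<close> by (simp add: \<phi>_def field_simps)
      qed
      then show ?thesis by (rule tendsto_eventually)
    qed
  qed
qed

section \<open>Relatively compact open sets with null boundary\<close>

lemma compact_if_closed_subset:
  fixes S :: "'a::t2_space set"
  shows "compact K \<Longrightarrow> closed S \<Longrightarrow> S \<subseteq> K \<Longrightarrow> compact S"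
  using compact_Int_closed[of K S] by (simp add: inf.absorb2)

lemma locally_compact_ball:
  fixes x :: "'a::metric_space"
  assumes "locally_compact_space (euclidean :: 'a topology)"
  obtains r where "0 < r" "compact (cball x r)"
proof -
  have "\<exists>U K. open U \<and> compact K \<and> x \<in> U \<and> U \<subseteq> K"
    using assms by (simp add: locally_compact_space_def)
  then obtain U K where "open U" "compact K" "x \<in> U" "U \<subseteq> K" by blast
  moreover from this obtain r where "0 < r" "cball x r \<subseteq> U" by (auto simp: open_contains_cball)
  ultimately show thesis
    using that[of r] compact_if_closed_subset[OF \<open>compact K\<close> closed_cball[of x r]] by blast
qed

lemma compact_imp_relatively_compact_open_superset:
  fixes F :: "'a::metric_space set"
  assumes "locally_compact_space (euclidean :: 'a topology)" "compact F"
  obtains U where "open U" "F \<subseteq> U" "compact (closure U)"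
proof -
  have "\<forall>x::'a. \<exists>r>0. compact (cball x r)"
    using locally_compact_ball[OF assms(1)] by blast
  then obtain r where r: "\<And>x::'a. 0 < r x" "\<And>x. compact (cball x (r x))"
    by metis
  have "F \<subseteq> (\<Union>x\<in>F. ball x (r x))" using r(1) by auto
  then obtain A where A: "A \<subseteq> F" "finite A" "F \<subseteq> (\<Union>x\<in>A. ball x (r x))"
    by (rule compactE_image[OF assms(2), rotated]) auto
  have "closure (\<Union>x\<in>A. ball x (r x)) \<subseteq> (\<Union>x\<in>A. cball x (r x))"
    using A(2) ball_subset_cball by (intro closure_minimal closed_UN) blast+
  moreover have "compact (\<Union>x\<in>A. cball x (r x))" using A r by (intro compact_UN) auto
  ultimately have "compact (closure (\<Union>x\<in>A. ball x (r x)))"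
    using compact_if_closed_subset[OF _ closed_closure] by blast
  then show thesis using A that[of "\<Union>x\<in>A. ball x (r x)"] by auto
qed

text \<open>The masses of the spheres about \<open>x\<close> are the point masses of the image of a
  finite measure under \<open>dist x\<close>, so only countably many radii can carry mass.\<close>

lemma null_sphere:
  fixes x :: "'a::metric_space"
  assumes [simp]: "sets \<mu> = sets borel" and fin: "emeasure \<mu> (cball x R) < \<infinity>" and "0 < R"
  obtains r where "0 < r" "r \<le> R" "emeasure \<mu> (sphere x r) = 0"
proof -
  define \<nu> where "\<nu> = distr (density \<mu> (indicator (cball x R))) borel (dist x)"
  have [measurable]: "dist x \<in> borel_measurable \<mu>"
  proof -
    have "dist x \<in> borel_measurable borel"
      by (intro borel_measurable_continuous_onI continuous_intros)
    then show ?thesis by (simp cong: measurable_cong_sets)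
  qed
  have em: "emeasure \<nu> A = emeasure \<mu> (cball x R \<inter> dist x -` A)" if [measurable]: "A \<in> sets borel" for A
  proof -
    have [simp]: "space \<mu> = UNIV" using sets_eq_imp_space_eq[OF assms(1)] by simp
    have "dist x -` A \<in> sets \<mu>"
      using measurable_sets[OF \<open>dist x \<in> borel_measurable \<mu>\<close> that] by simp
    then have "emeasure \<nu> A = (\<integral>\<^sup>+y. indicator (cball x R) y * indicator (dist x -` A) y \<partial>\<mu>)"
      unfolding \<nu>_def
      by (subst emeasure_distr, simp, simp, subst emeasure_density) (auto intro!: borel_measurable_indicator)
    also have "\<dots> = (\<integral>\<^sup>+y. indicator (cball x R \<inter> dist x -` A) y \<partial>\<mu>)"
      by (simp add: indicator_inter_arith)
    finally show ?thesis
      using \<open>dist x -` A \<in> sets \<mu>\<close> by (subst (asm) nn_integral_indicator) auto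
  qed
  interpret \<nu>: finite_measure \<nu>
  proof (rule finite_measureI)
    have "space \<nu> = UNIV" by (simp add: \<nu>_def)
    then show "emeasure \<nu> (space \<nu>) \<noteq> \<infinity>" using fin em[of UNIV] by simp
  qed
  have "{0<..<R} - {r. measure \<nu> {r} \<noteq> 0} \<noteq> {}"
    unfolding Diff_eq_empty_iff
    using countable_subset[OF _ \<nu>.countable_support] uncountable_open_interval[of 0 R] \<open>0 < R\<close> by blast
  then obtain r where r: "0 < r" "r < R" "measure \<nu> {r} = 0" by auto
  then have "emeasure \<mu> (cball x R \<inter> dist x -` {r}) = 0"
    using em[of "{r}"] by (simp add: \<nu>.emeasure_eq_measure)
  also have "cball x R \<inter> dist x -` {r} = sphere x r" using r by auto
  finally show thesis using r that by simp
qed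

text \<open>Every point is the centre of a relatively compact ball whose bounding sphere is null.
  Lindelof leaves countably many such balls, and the frontier of a finite union of them lies in the
  union of the spheres.\<close>

lemma Radon_exhaustion:
  fixes \<mu> :: "'a::{metric_space, second_countable_topology} measure"
  assumes lc: "locally_compact_space (euclidean :: 'a topology)" and \<mu>: "Radon_measure \<mu>"
  obtains V :: "nat \<Rightarrow> 'a set" where "incseq V" "\<And>k. open (V k)" "\<And>k. compact (closure (V k))"
    "(\<Union>k. V k) = UNIV" "\<And>k. emeasure \<mu> (frontier (V k)) = 0"
proof -
  have sets [simp]: "sets \<mu> = sets borel" using \<mu> by (simp add: Radon_measure_def)
  have "\<exists>r>0. compact (cball x r) \<and> emeasure \<mu> (sphere x r) = 0" for x
  proof -
    obtain R where R: "0 < R" "compact (cball x R)" using locally_compact_ball[OF lc] .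
    then obtain r where r: "0 < r" "r \<le> R" "emeasure \<mu> (sphere x r) = 0"
      using null_sphere[OF sets, of x R] \<mu> by (auto simp: Radon_measure_def)
    have "compact (cball x r)"
      using R r by (intro compact_if_closed_subset[OF R(2)]) auto
    then show ?thesis using r by auto
  qed
  then obtain r where r: "\<And>x. 0 < r x" "\<And>x. compact (cball x (r x))" "\<And>x. emeasure \<mu> (sphere x (r x)) = 0"
    by metis
  obtain \<B> where \<B>: "\<B> \<subseteq> range (\<lambda>x. ball x (r x))" "countable \<B>" "\<Union>\<B> = \<Union>(range (\<lambda>x. ball x (r x)))"
    by (rule Lindelof[of "range (\<lambda>x. ball x (r x))"]) auto
  have cover: "\<Union>\<B> = UNIV" unfolding \<B>(3) using r(1) by (auto intro!: exI[of _ x for x])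
  then have ne: "\<B> \<noteq> {}" by auto
  \<comment> \<open>The enumeration may repeat members, so a finite subcover is included.\<close>
  define B where "B = from_nat_into \<B>"
  have range_B: "range B = \<B>" unfolding B_def using ne \<B>(2) by (rule range_from_nat_into)
  define c where "c i = (SOME x. B i = ball x (r x))" for i
  have B: "B i = ball (c i) (r (c i))" for i
  proof -
    have "\<exists>x. B i = ball x (r x)" using range_B \<B>(1) by auto
    then show ?thesis unfolding c_def by (rule someI_ex)
  qed
  define V where "V k = (\<Union>i\<le>k. B i)" for k
  have clB: "closure (B i) \<subseteq> cball (c i) (r (c i))" for i
    unfolding B by (intro closure_minimal ball_subset_cball closed_cball)
  have clV: "closure (V k) \<subseteq> (\<Union>i\<le>k. closure (B i))" for k
    unfolding V_def using closure_subset by (intro closure_minimal closed_UN) fastforce+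
  show thesis
  proof (rule that)
    show "incseq V" unfolding V_def by (auto simp: incseq_def intro: order.trans)
    show op: "open (V k)" for k unfolding V_def B by auto
    show "(\<Union>k. V k) = UNIV" using cover range_B unfolding V_def by blast
    show "compact (closure (V k))" for k
    proof -
      have "compact (closure (B i))" for i
        by (rule compact_if_closed_subset[OF r(2) closed_closure clB])
      then have "compact (\<Union>i\<le>k. closure (B i))" by (intro compact_UN) auto
      then show ?thesis by (rule compact_if_closed_subset[OF _ closed_closure clV])
    qed
    show "emeasure \<mu> (frontier (V k)) = 0" for k
    proof -
      have sub: "frontier (V k) \<subseteq> (\<Union>i\<le>k. sphere (c i) (r (c i)))"
      proof
        fix y assume "y \<in> frontier (V k)"
        then have "y \<in> closure (V k)" "y \<notin> V k" using op by (auto simp: frontier_def interior_open)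
        then obtain i where "i \<le> k" "y \<in> closure (B i)" "y \<notin> B i" using clV[of k] by (auto simp: V_def)
        then show "y \<in> (\<Union>i\<le>k. sphere (c i) (r (c i)))" using clB[of i] by (auto simp: B intro!: bexI[of _ i])
      qed
      have sphere: "sphere x s \<in> sets borel" for x :: 'a and s
      proof -
        have "sphere x s = cball x s - ball x s" by auto
        then show ?thesis by auto
      qed
      have "(\<Union>i\<le>k. sphere (c i) (r (c i))) \<in> null_sets \<mu>"
        using r(3) by (intro null_sets_UN') (auto simp: null_sets_def sphere)
      then have "frontier (V k) \<in> null_sets \<mu>" by (rule null_sets_subset) (use sub in auto)
      then show ?thesis by auto
    qed
  qed
qed

section \<open>Vague convergence on continuity sets\<close>

lemma Radon_finite_relatively_compact:
  assumes "Radon_measure \<mu>" "compact (closure V)"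
  shows "emeasure \<mu> V < \<infinity>"
proof -
  have "emeasure \<mu> V \<le> emeasure \<mu> (closure V)"
    using assms by (intro emeasure_mono closure_subset) (auto simp: Radon_measure_def)
  then show ?thesis using assms by (auto simp: Radon_measure_def intro: le_less_trans)
qed

lemma integrable_indicator_continuous:
  fixes g :: "'a::t2_space \<Rightarrow> real"
  assumes \<mu>: "Radon_measure \<mu>" and V: "open V" "compact (closure V)"
    and g: "continuous_on UNIV g"
  shows "integrable \<mu> (\<lambda>x. indicator V x * g x)"
proof -
  have [measurable_cong]: "sets \<mu> = sets borel" using \<mu> by (simp add: Radon_measure_def)
  have [measurable]: "g \<in> borel_measurable borel" "V \<in> sets borel"
    using V by (auto intro: borel_measurable_continuous_onI g)
  have "bounded (g ` closure V)"
    using V g by (intro compact_imp_bounded compact_continuous_image) (auto intro: continuous_on_subset)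
  then obtain B where B: "\<And>x. x \<in> closure V \<Longrightarrow> norm (g x) \<le> B" by (auto simp: bounded_iff)
  show ?thesis
  proof (rule integrableI_bounded_set[where A = V and B = B])
    show "emeasure \<mu> V < \<infinity>" by (rule Radon_finite_relatively_compact[OF \<mu> V(2)])
    show "AE x in \<mu>. x \<in> V \<longrightarrow> norm (indicator V x * g x) \<le> B"
      using B closure_subset[of V] by (auto simp: indicator_def)
  qed auto
qed

text \<open>Take cutoffs \<open>\<phi> j\<close> equal to 1 on the frontier. Multiplying
  \<open>indicator V x * g x\<close> by \<open>1 - \<phi> j x\<close> makes it an admissible test
  function, at the cost of a constant times the integral of \<open>\<phi> j\<close>. This cost is
  small under \<open>\<mu>\<close> because the frontier is null, and eventually small under
  \<open>\<mu>s n\<close> because \<open>\<phi> j\<close> is itself a test function.\<close>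

theorem vague_limit_continuity_set:
  fixes g :: "'a::metric_space \<Rightarrow> real"
  assumes lc: "locally_compact_space (euclidean :: 'a topology)"
    and \<mu>: "Radon_measure \<mu>" and \<mu>s: "\<And>n. Radon_measure (\<mu>s n)" and vague: "vague_limit \<mu>s \<mu>"
    and V: "open V" "compact (closure V)" and null: "emeasure \<mu> (frontier V) = 0"
    and g: "continuous_on UNIV g"
  shows "(\<lambda>n. \<integral>x. indicator V x * g x \<partial>\<mu>s n) \<longlonglongrightarrow> (\<integral>x. indicator V x * g x \<partial>\<mu>)"
proof (rule LIMSEQ_I)
  fix e :: real assume "0 < e"
  have "compact (frontier V)"
    using V compact_if_closed_subset[OF V(2), of "frontier V"] by (auto simp: frontier_def)
  then obtain U where U: "open U" "frontier V \<subseteq> U" "compact (closure U)"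
    by (rule compact_imp_relatively_compact_open_superset[OF lc])
  obtain \<phi> :: "nat \<Rightarrow> 'a \<Rightarrow> real" where \<phi>: "\<And>j. continuous_on UNIV (\<phi> j)" "\<And>j y. 0 \<le> \<phi> j y" "\<And>j y. \<phi> j y \<le> 1"
    "\<And>j y. y \<in> frontier V \<Longrightarrow> \<phi> j y = 1" "\<And>j y. y \<notin> U \<Longrightarrow> \<phi> j y = 0"
    "\<And>y. y \<notin> frontier V \<Longrightarrow> (\<lambda>j. \<phi> j y) \<longlonglongrightarrow> 0"
    using compact_cutoff_functions[OF \<open>compact (frontier V)\<close> U(1,2)] by blast
  have \<phi>_ind: "\<phi> j = (\<lambda>x. indicator U x * \<phi> j x)" for j
    using \<phi>(5) by (fastforce simp: indicator_def)
  have \<phi>_int: "integrable \<nu> (\<phi> j)" if "Radon_measure \<nu>" for \<nu> j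
    by (subst \<phi>_ind, rule integrable_indicator_continuous) (use that U \<phi> in auto)
  have [measurable_cong]: "sets \<mu> = sets borel" using \<mu> by (simp add: Radon_measure_def)
  have [measurable]: "\<phi> j \<in> borel_measurable borel" for j
    by (intro borel_measurable_continuous_onI \<phi>)
  have "(\<lambda>j. integral\<^sup>L \<mu> (\<phi> j)) \<longlonglongrightarrow> integral\<^sup>L \<mu> (\<lambda>_. 0)"
  proof (rule integral_dominated_convergence)
    show "integrable \<mu> (\<lambda>x. indicator U x * 1 :: real)"
      by (rule integrable_indicator_continuous) (use \<mu> U in auto)
    have "AE x in \<mu>. x \<notin> frontier V"
      using null by (intro AE_not_in) (auto simp: null_sets_def)
    then show "AE x in \<mu>. (\<lambda>j. \<phi> j x) \<longlonglongrightarrow> 0"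
      by eventually_elim (rule \<phi>)
    show "AE x in \<mu>. norm (\<phi> j x) \<le> indicator U x * 1" for j
      using \<phi>(2,3,5) by (auto simp: indicator_def)
  qed measurable
  then have \<phi>0: "(\<lambda>j. integral\<^sup>L \<mu> (\<phi> j)) \<longlonglongrightarrow> 0" by simp
  have "bounded (g ` closure V)"
    using V g by (intro compact_imp_bounded compact_continuous_image) (auto intro: continuous_on_subset)
  then obtain B where B: "0 < B" "\<And>x. x \<in> closure V \<Longrightarrow> \<bar>g x\<bar> \<le> B" by (auto simp: bounded_pos)
  \<comment> \<open>The choice of \<open>j\<close> looks at \<open>\<mu>\<close> alone; the strict
    inequality then passes to \<open>\<mu>s n\<close> for large \<open>n\<close>. Each of the three
    errors at the end is below \<open>e / 4\<close>.\<close>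
  have "eventually (\<lambda>j. integral\<^sup>L \<mu> (\<phi> j) < e / (4 * B)) sequentially"
    using \<open>0 < e\<close> B by (intro order_tendstoD[OF \<phi>0]) auto
  then obtain j where j: "integral\<^sup>L \<mu> (\<phi> j) < e / (4 * B)" by (meson eventually_happens trivial_limit_sequentially)
  define h where "h x = indicator V x * (g x * (1 - \<phi> j x))" for x
  \<comment> \<open>\<open>h\<close> is continuous across the frontier because \<open>1 - \<phi> j\<close> vanishes there.\<close>
  have h_cont: "continuous_on UNIV h"
  proof -
    have "continuous_on (closure V \<union> - V) (\<lambda>x. if x \<in> V then g x * (1 - \<phi> j x) else 0)"
    proof (rule continuous_on_cases)
      show "continuous_on (closure V) (\<lambda>x. g x * (1 - \<phi> j x))"
        by (intro continuous_intros continuous_on_subset[OF g] continuous_on_subset[OF \<phi>(1)]) auto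
      show "\<forall>x. x \<in> closure V \<and> x \<notin> V \<or> x \<in> - V \<and> x \<in> V \<longrightarrow> g x * (1 - \<phi> j x) = 0"
        using \<phi>(4) V by (auto simp: frontier_def interior_open)
    qed (use V in auto)
    moreover have "closure V \<union> - V = UNIV" using closure_subset by auto
    moreover have "h = (\<lambda>x. if x \<in> V then g x * (1 - \<phi> j x) else 0)" by (auto simp: h_def)
    ultimately show ?thesis by simp
  qed
  have close: "\<bar>(\<integral>x. indicator V x * g x \<partial>\<nu>) - integral\<^sup>L \<nu> h\<bar> \<le> B * integral\<^sup>L \<nu> (\<phi> j)" if \<nu>: "Radon_measure \<nu>" for \<nu>
  proof -
    have int1: "integrable \<nu> (\<lambda>x. indicator V x * g x)"
      by (rule integrable_indicator_continuous[OF \<nu> V g])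
    have int2: "integrable \<nu> h"
      unfolding h_def
      by (rule integrable_indicator_continuous[OF \<nu> V]) (intro continuous_intros g \<phi>)
    have "\<bar>(\<integral>x. indicator V x * g x \<partial>\<nu>) - integral\<^sup>L \<nu> h\<bar> = \<bar>\<integral>x. indicator V x * g x - h x \<partial>\<nu>\<bar>"
      using int1 int2 by simp
    also have "\<dots> \<le> (\<integral>x. B * \<phi> j x \<partial>\<nu>)"
    proof (rule integral_abs_bound[THEN order.trans], rule integral_mono)
      show "\<bar>indicator V x * g x - h x\<bar> \<le> B * \<phi> j x" for x
        using B(2)[of x] closure_subset[of V] \<phi>(2)[of j x] B(1)
        by (auto simp: h_def indicator_def algebra_simps abs_mult mult_right_mono[of "\<bar>g x\<bar>" B "\<phi> j x"])
    qed (use int1 int2 \<phi>_int[OF \<nu>] in auto)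
    finally show ?thesis by simp
  qed
  have "compact (closure {x. h x \<noteq> 0})"
    by (rule compact_if_closed_subset[OF V(2)]) (auto intro!: closure_mono simp: h_def indicator_def split: if_splits)
  then have "(\<lambda>n. integral\<^sup>L (\<mu>s n) h) \<longlonglongrightarrow> integral\<^sup>L \<mu> h"
    using vague h_cont by (auto simp: vague_limit_def)
  then have ev1: "eventually (\<lambda>n. dist (integral\<^sup>L (\<mu>s n) h) (integral\<^sup>L \<mu> h) < e / 4) sequentially"
    by (rule tendstoD) (use \<open>0 < e\<close> in auto)
  have "compact (closure {x. \<phi> j x \<noteq> 0})"
    by (rule compact_if_closed_subset[OF U(3)]) (use \<phi>(5) in \<open>auto intro!: closure_mono\<close>)
  then have "(\<lambda>n. integral\<^sup>L (\<mu>s n) (\<phi> j)) \<longlonglongrightarrow> integral\<^sup>L \<mu> (\<phi> j)"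
    using vague \<phi>(1) by (auto simp: vague_limit_def)
  from order_tendstoD(2)[OF this j]
  have "eventually (\<lambda>n. norm ((\<integral>x. indicator V x * g x \<partial>\<mu>s n) - (\<integral>x. indicator V x * g x \<partial>\<mu>)) < e) sequentially"
    using ev1
  proof eventually_elim
    case (elim n)
    have "B * integral\<^sup>L (\<mu>s n) (\<phi> j) < e / 4" "B * integral\<^sup>L \<mu> (\<phi> j) < e / 4"
      using elim(1) j B by (auto simp: field_simps)
    then show ?case
      using close[OF \<mu>] close[OF \<mu>s, of n] elim(2) unfolding dist_real_def real_norm_def by linarith
  qed
  then show "\<exists>no. \<forall>n\<ge>no. norm ((\<integral>x. indicator V x * g x \<partial>\<mu>s n) - (\<integral>x. indicator V x * g x \<partial>\<mu>)) < e"
    by (simp add: eventually_sequentially)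
qed

text \<open>Uniform continuity of \<open>k\<close> on the compact square of
  \<open>closure V\<close>, together with a bound on the masses of \<open>V\<close>, makes the
  integrals equicontinuous in \<open>x\<close>, uniformly in \<open>n\<close>. Convergence then has
  to be checked only at the centres of a finite net.\<close>

theorem vague_limit_kernel_uniform:
  fixes k :: "'a::metric_space \<Rightarrow> 'a \<Rightarrow> real"
  assumes lc: "locally_compact_space (euclidean :: 'a topology)"
    and \<mu>: "Radon_measure \<mu>" and \<mu>s: "\<And>n. Radon_measure (\<mu>s n)" and vague: "vague_limit \<mu>s \<mu>"
    and V: "open V" "compact (closure V)" and null: "emeasure \<mu> (frontier V) = 0"
    and k: "continuous_on UNIV (\<lambda>(x, y). k x y)" and "0 < e"
  shows "\<forall>\<^sub>F n in sequentially. \<forall>x\<in>V.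
    \<bar>(\<integral>y. indicator V y * k x y \<partial>\<mu>s n) - (\<integral>y. indicator V y * k x y \<partial>\<mu>)\<bar> < e"
proof -
  have k_cont: "continuous_on UNIV (k x)" for x
  proof -
    have "continuous_on UNIV ((\<lambda>(x, y). k x y) \<circ> Pair x)"
      by (intro continuous_on_compose continuous_on_subset[OF k]) (auto intro: continuous_intros)
    then show ?thesis by (simp add: comp_def)
  qed
  note lim = vague_limit_continuity_set[OF lc \<mu> \<mu>s vague V null]
  \<comment> \<open>The constant 1 as integrand shows that the masses of \<open>V\<close> converge,
    hence are bounded.\<close>
  have "(\<lambda>n. \<integral>x. indicator V x * (1 :: real) \<partial>\<mu>s n) \<longlonglongrightarrow> (\<integral>x. indicator V x * 1 \<partial>\<mu>)"
    by (rule lim) (rule continuous_on_const)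
  then have mass: "(\<lambda>n. measure (\<mu>s n) V) \<longlonglongrightarrow> measure \<mu> V"
    using V \<mu> \<mu>s by (simp add: Radon_measure_def sets_eq_imp_space_eq[of _ borel])
  from BseqD[OF convergent_imp_Bseq[OF convergentI[OF mass]]]
  obtain M' where M': "\<And>n. measure (\<mu>s n) V \<le> M'" by auto
  \<comment> \<open>The 1 keeps \<open>M\<close> positive, so that \<open>e / (4 * M)\<close> is a
    valid tolerance.\<close>
  define M where "M = max 1 (max M' (measure \<mu> V))"
  have M: "0 < M" "measure \<mu> V \<le> M" "\<And>n. measure (\<mu>s n) V \<le> M"
    using M' by (auto simp: M_def le_max_iff_disj)
  have "uniformly_continuous_on (closure V \<times> closure V) (\<lambda>(x, y). k x y)"
    by (intro compact_uniformly_continuous continuous_on_subset[OF k] compact_Times V) auto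
  then obtain d where d: "0 < d" "\<And>x x' y. x \<in> closure V \<Longrightarrow> x' \<in> closure V \<Longrightarrow> y \<in> closure V \<Longrightarrow>
      dist x' x < d \<Longrightarrow> \<bar>k x' y - k x y\<bar> < e / (4 * M)"
  proof -
    assume uc: "uniformly_continuous_on (closure V \<times> closure V) (\<lambda>(x, y). k x y)"
      and that: "\<And>d. 0 < d \<Longrightarrow> (\<And>x x' y. x \<in> closure V \<Longrightarrow> x' \<in> closure V \<Longrightarrow> y \<in> closure V \<Longrightarrow>
        dist x' x < d \<Longrightarrow> \<bar>k x' y - k x y\<bar> < e / (4 * M)) \<Longrightarrow> thesis"
    have "0 < e / (4 * M)" using \<open>0 < e\<close> M by simp
    from uc[unfolded uniformly_continuous_on_def, rule_format, OF this]
    obtain d where d: "0 < d" "\<And>a b. a \<in> closure V \<times> closure V \<Longrightarrow> b \<in> closure V \<times> closure V \<Longrightarrow>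
       dist b a < d \<Longrightarrow> dist (case b of (x, y) \<Rightarrow> k x y) (case a of (x, y) \<Rightarrow> k x y) < e / (4 * M)"
      by blast
    show thesis
      by (rule that[OF d(1)]) (use d(2)[of "(_, y)" "(_, y)" for y] in \<open>auto simp: dist_Pair_Pair dist_real_def\<close>)
  qed
  have close: "\<bar>(\<integral>y. indicator V y * k x y \<partial>\<nu>) - (\<integral>y. indicator V y * k a y \<partial>\<nu>)\<bar> \<le> e / 4"
    if \<nu>: "Radon_measure \<nu>" "measure \<nu> V \<le> M" and x: "x \<in> closure V" "a \<in> closure V" "dist x a < d" for \<nu> x a
  proof -
    note int = integrable_indicator_continuous[OF \<nu>(1) V]
    have "\<bar>(\<integral>y. indicator V y * k x y \<partial>\<nu>) - (\<integral>y. indicator V y * k a y \<partial>\<nu>)\<bar>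
       = \<bar>\<integral>y. indicator V y * k x y - indicator V y * k a y \<partial>\<nu>\<bar>"
      by (subst Bochner_Integration.integral_diff) (auto intro: int k_cont)
    also have "\<dots> \<le> (\<integral>y. indicator V y * (e / (4 * M)) \<partial>\<nu>)"
    proof (rule integral_abs_bound[THEN order.trans], rule integral_mono)
      show "\<bar>indicator V y * k x y - indicator V y * k a y\<bar> \<le> indicator V y * (e / (4 * M))" for y
        using d(2)[OF x(2,1), of y] x(3) closure_subset[of V] by (auto simp: indicator_def intro: less_imp_le)
    qed (auto intro!: integrable_abs Bochner_Integration.integrable_diff int k_cont continuous_intros)
    also have "\<dots> = measure \<nu> V * (e / (4 * M))"
      using V \<nu> by (simp add: Radon_measure_def sets_eq_imp_space_eq[of _ borel])
    also have "\<dots> \<le> M * (e / (4 * M))"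
      using \<nu> M \<open>0 < e\<close> by (intro mult_right_mono) auto
    finally show ?thesis using M by simp
  qed
  have "closure V \<subseteq> (\<Union>a\<in>closure V. ball a d)" using d(1) by auto
  then obtain A where A: "A \<subseteq> closure V" "finite A" "closure V \<subseteq> (\<Union>a\<in>A. ball a d)"
    by (rule compactE_image[OF V(2), rotated]) auto
  have "\<forall>\<^sub>F n in sequentially. \<forall>a\<in>A.
      dist (\<integral>y. indicator V y * k a y \<partial>\<mu>s n) (\<integral>y. indicator V y * k a y \<partial>\<mu>) < e / 4"
    using A(2) \<open>0 < e\<close> by (intro eventually_ball_finite ballI tendstoD[OF lim] k_cont) auto
  then show ?thesis
  proof eventually_elim
    case (elim n)
    show ?case
    proof
      fix x assume "x \<in> V"
      then have x: "x \<in> closure V" using closure_subset by auto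
      with A obtain a where a: "a \<in> A" "dist x a < d" by (auto simp: dist_commute)
      with A have "a \<in> closure V" by auto
      note c = close[OF _ _ x this a(2)]
      show "\<bar>(\<integral>y. indicator V y * k x y \<partial>\<mu>s n) - (\<integral>y. indicator V y * k x y \<partial>\<mu>)\<bar> < e"
        using c[OF \<mu> M(2)] c[OF \<mu>s M(3), of n] elim[rule_format, OF a(1)] \<open>0 < e\<close>
        unfolding dist_real_def by linarith
    qed
  qed
qed

section \<open>Restrictions of measures to open sets\<close>

lemma nn_integral_restr:
  assumes "sets \<mu> = sets borel" "open V" "f \<in> borel_measurable borel"
  shows "(\<integral>\<^sup>+y. f y \<partial>restr \<mu> V) = (\<integral>\<^sup>+y\<in>V. f y \<partial>\<mu>)"
proof -
  have [measurable_cong]: "sets \<mu> = sets borel" by fact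
  have [measurable]: "V \<in> sets borel" "f \<in> borel_measurable borel" using assms by auto
  show ?thesis unfolding restr_def by (subst nn_integral_density) (auto simp: mult.commute)
qed

lemma AE_restr:
  assumes "sets \<mu> = sets borel" "open V"
  shows "AE y in restr \<mu> V. y \<in> V"
proof -
  have [measurable_cong]: "sets \<mu> = sets borel" by fact
  have [measurable]: "V \<in> sets borel" using assms by auto
  show ?thesis unfolding restr_def by (subst AE_density) (auto simp: indicator_def)
qed

section \<open>Convergence of potentials\<close>

context submarkov_density begin

text \<open>A Henstock-Kurzweil integral over a closed interval, the form to which the continuity
  theorem for integrals with parameters applies. For \<open>0 < a\<close> it agrees with the
  Lebesgue integral over \<open>{a<..b}\<close>.\<close>

definition interval_kernel :: "real \<Rightarrow> real \<Rightarrow> 'a \<Rightarrow> 'a \<Rightarrow> real" where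
  "interval_kernel a b x y = integral {a..b} (\<lambda>s. exp (- s) * enn2real (p s x y))"

text \<open>\<open>enn2real\<close> sends infinity to 0 and jumps there; finiteness of
  \<open>p\<close> keeps the values away from that point.\<close>

lemma enn2real_p_continuous: "continuous_on ({0<..} \<times> UNIV) (\<lambda>(t, x, y). enn2real (p t x y))"
proof -
  have "((\<lambda>w. enn2real (case w of (t, x, y) \<Rightarrow> p t x y)) \<longlongrightarrow> enn2real (case w of (t, x, y) \<Rightarrow> p t x y))
      (at w within {0<..} \<times> UNIV)" if w: "w \<in> {0<..} \<times> UNIV" for w
  proof (rule tendsto_enn2real)
    have "ennreal (enn2real (case w of (t, x, y) \<Rightarrow> p t x y)) = (case w of (t, x, y) \<Rightarrow> p t x y)"
      using w p_finite by (auto simp: ennreal_enn2real_if less_top)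
    then show "((\<lambda>w. case w of (t, x, y) \<Rightarrow> p t x y) \<longlongrightarrow> ennreal (enn2real (case w of (t, x, y) \<Rightarrow> p t x y)))
      (at w within {0<..} \<times> UNIV)"
      using p_continuous[unfolded continuous_on_def, rule_format, OF w] by (simp only:)
  qed simp
  then show ?thesis by (simp add: continuous_on_def split_beta)
qed

lemma interval_kernel_continuous:
  assumes "0 < a"
  shows "continuous_on UNIV (\<lambda>(x, y). interval_kernel a b x y)"
proof -
  have "continuous_on (UNIV \<times> cbox a b) ((\<lambda>(t, x, y). enn2real (p t x y)) \<circ> (\<lambda>(w, s). (s, fst w, snd w)))"
    unfolding split_beta
    by (rule continuous_on_compose)
       (use assms in \<open>auto intro!: continuous_intros continuous_on_subset[OF enn2real_p_continuous[unfolded split_beta]]\<close>)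
  then have "continuous_on (UNIV \<times> cbox a b) (\<lambda>(w, s). exp (- s) * enn2real (p s (fst w) (snd w)))"
    by (auto simp: comp_def split_beta intro!: continuous_intros)
  from integral_continuous_on_param[OF this]
  show ?thesis by (simp add: interval_kernel_def split_beta)
qed

lemma interval_kernel_nonneg: "0 \<le> interval_kernel a b x y"
  \<comment> \<open>Without integrability, \<open>integral\<close> takes its default value
    0.\<close>
  unfolding interval_kernel_def by (cases "(\<lambda>s. exp (- s) * enn2real (p s x y)) integrable_on {a..b}")
    (auto intro!: Henstock_Kurzweil_Integration.integral_nonneg simp: not_integrable_integral)

lemma nn_integral_interval_kernel:
  assumes "0 < a"
  shows "(\<integral>\<^sup>+s\<in>{a<..b}. ennreal (exp (- s)) * p s x y \<partial>lborel) = ennreal (interval_kernel a b x y)"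
proof -
  let ?f = "\<lambda>s. exp (- s) * enn2real (p s x y)"
  have "continuous_on {a..b} ((\<lambda>(t, x, y). enn2real (p t x y)) \<circ> (\<lambda>s. (s, x, y)))"
    by (rule continuous_on_compose)
       (use assms in \<open>auto intro!: continuous_intros continuous_on_subset[OF enn2real_p_continuous]\<close>)
  then have "continuous_on {a..b} ?f"
    by (auto simp: comp_def intro!: continuous_intros)
  then have "(?f has_integral interval_kernel a b x y) {a..b}"
    unfolding interval_kernel_def by (intro integrable_integral integrable_continuous_real)
  then have "((\<lambda>s. if s \<in> {a..b} then ?f s else 0) has_integral interval_kernel a b x y) UNIV"
    by (subst has_integral_restrict_UNIV)
  then have "(\<integral>\<^sup>+s. ennreal (if s \<in> {a..b} then ?f s else 0) \<partial>lborel) = ennreal (interval_kernel a b x y)"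
    by (intro nn_integral_has_integral_lborel) auto
  also have "(\<integral>\<^sup>+s. ennreal (if s \<in> {a..b} then ?f s else 0) \<partial>lborel)
      = (\<integral>\<^sup>+s\<in>{a<..b}. ennreal (exp (- s)) * p s x y \<partial>lborel)"
  proof (rule nn_integral_cong_AE)
    \<comment> \<open>The integrands can differ only at the single time \<open>a\<close>, since one
      interval is closed and the other half-open; elsewhere \<open>enn2real\<close> loses nothing
      because \<open>p\<close> is finite.\<close>
    show "AE s in lborel. ennreal (if s \<in> {a..b} then ?f s else 0)
        = ennreal (exp (- s)) * p s x y * indicator {a<..b} s"
      using AE_lborel_singleton[of a]
      by eventually_elim (use assms p_finite in \<open>auto simp: indicator_def ennreal_mult less_top\<close>)
  qed
  finally show ?thesis by simp
qed

lemma density_measure_restr: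
  assumes "Radon_measure \<mu>" "open V" "compact (closure V)"
  shows "density_measure m p (restr \<mu> V)"
proof -
  have s: "sets \<mu> = sets borel" using assms by (simp add: Radon_measure_def)
  have "finite_measure (restr \<mu> V)"
  proof
    have "emeasure (restr \<mu> V) (space (restr \<mu> V)) = emeasure \<mu> V"
    proof -
      have V: "V \<in> sets \<mu>" using s assms by simp
      then have "emeasure (restr \<mu> V) (space \<mu>) = (\<integral>\<^sup>+y. indicator V y * indicator (space \<mu>) y \<partial>\<mu>)"
        unfolding restr_def by (intro emeasure_density) auto
      also have "\<dots> = (\<integral>\<^sup>+y. indicator V y \<partial>\<mu>)"
        by (rule nn_integral_cong) simp
      finally show ?thesis using V by (simp add: restr_def)
    qed
    then show "emeasure (restr \<mu> V) (space (restr \<mu> V)) \<noteq> \<infinity>"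
      using Radon_finite_relatively_compact[OF assms(1,3)] by simp
  qed
  then show ?thesis
    using s by (intro density_measure.intro submarkov_density_axioms density_measure_axioms.intro)
      (auto simp: restr_def)
qed

text \<open>Away from time 0 the kernel is real and continuous in \<open>y\<close>, so after Tonelli
  the extended integral becomes a real one, to which vague convergence applies.\<close>

lemma discounted_flow_Ioc_eq:
  assumes \<mu>: "Radon_measure \<mu>" and V: "open V" "compact (closure V)" and "0 < a"
  shows "discounted_flow (restr \<mu> V) {a<..b} x
    = ennreal (\<integral>y. indicator V y * interval_kernel a b x y \<partial>\<mu>)"
proof -
  interpret \<nu>: density_measure m p "restr \<mu> V" by (rule density_measure_restr[OF \<mu> V])
  interpret pair_sigma_finite lborel "restr \<mu> V" by unfold_locales
  have s: "sets \<mu> = sets borel" using \<mu> by (simp add: Radon_measure_def)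
  have k_cont: "continuous_on UNIV (interval_kernel a b x)"
  proof -
    have "continuous_on UNIV ((\<lambda>(x, y). interval_kernel a b x y) \<circ> Pair x)"
      by (intro continuous_on_compose continuous_on_subset[OF interval_kernel_continuous[OF \<open>0 < a\<close>]])
         (auto intro: continuous_intros)
    then show ?thesis by (simp add: comp_def)
  qed
  have [measurable]: "interval_kernel a b x \<in> borel_measurable borel"
    by (intro borel_measurable_continuous_onI k_cont)
  have "discounted_flow (restr \<mu> V) {a<..b} x
      = (\<integral>\<^sup>+s. \<integral>\<^sup>+y. ennreal (exp (- s)) * p s x y * indicator {a<..b} s \<partial>restr \<mu> V \<partial>lborel)"
    unfolding discounted_flow_def flow_def
    by (subst nn_integral_cmult[symmetric], measurable, subst nn_integral_multc[symmetric], measurable)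
  also have "\<dots> = (\<integral>\<^sup>+y. \<integral>\<^sup>+s. ennreal (exp (- s)) * p s x y * indicator {a<..b} s \<partial>lborel \<partial>restr \<mu> V)"
    by (rule Fubini'[symmetric]) measurable
  also have "\<dots> = (\<integral>\<^sup>+y. ennreal (interval_kernel a b x y) \<partial>restr \<mu> V)"
    by (simp add: nn_integral_interval_kernel \<open>0 < a\<close>)
  also have "\<dots> = (\<integral>\<^sup>+y\<in>V. ennreal (interval_kernel a b x y) \<partial>\<mu>)"
    by (rule nn_integral_restr[OF s V(1)]) measurable
  also have "\<dots> = (\<integral>\<^sup>+y. ennreal (indicator V y * interval_kernel a b x y) \<partial>\<mu>)"
    by (auto intro!: nn_integral_cong simp: indicator_def)
  also have "\<dots> = ennreal (\<integral>y. indicator V y * interval_kernel a b x y \<partial>\<mu>)"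
    by (intro nn_integral_eq_integral integrable_indicator_continuous[OF \<mu> V k_cont])
       (simp add: interval_kernel_nonneg)
  finally show ?thesis .
qed

end

text \<open>The bounds on the two outer parts make \<open>P\<close> finite, so
  \<open>enn2real P\<close> is not the default value 0 taken at infinity.\<close>

lemma enn2real_sandwich:
  assumes "P = A + (ennreal I + C)" "A \<le> ennreal u" "C \<le> ennreal u" "0 \<le> I" "0 \<le> u"
  shows "I \<le> enn2real P" "enn2real P \<le> I + 2 * u"
proof -
  have le: "P \<le> ennreal (I + 2 * u)"
  proof -
    have "A + (ennreal I + C) \<le> ennreal u + (ennreal I + ennreal u)"
      by (intro add_mono assms order.refl)
    also have "\<dots> = ennreal (I + 2 * u)"
      using assms by (simp flip: ennreal_plus)
    finally show ?thesis using assms(1) by simp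
  qed
  have ge: "ennreal I \<le> P" using assms(1) by (simp add: add_increasing add_increasing2)
  have "P < \<infinity>" using le by (auto intro: le_less_trans)
  then obtain r where r: "P = ennreal r" "0 \<le> r" by (cases P) auto
  show "I \<le> enn2real P" using ge r by simp
  show "enn2real P \<le> I + 2 * u" using le r assms by (simp del: ennreal_plus)
qed

section \<open>Estimates along the sequence on a single continuity set\<close>

locale vague_setting = submarkov_density m p
  for m :: "'a::{metric_space, second_countable_topology} measure" and p +
  fixes \<mu> :: "'a measure" and \<mu>s :: "nat \<Rightarrow> 'a measure" and V :: "'a set"
  assumes lc: "locally_compact_space (euclidean :: 'a topology)"
    and Radon: "Radon_measure \<mu>" and Radon_s: "\<And>n. Radon_measure (\<mu>s n)"
    and vague: "vague_limit \<mu>s \<mu>"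
    and V: "open V" "compact (closure V)" and null: "emeasure \<mu> (frontier V) = 0"
    and B3: "((\<lambda>t. SUP n. SUP x\<in>closure V. \<integral>\<^sup>+s\<in>{0<..t}. (\<integral>\<^sup>+y\<in>closure V. p s x y \<partial>\<mu>s n) \<partial>lborel) \<longlongrightarrow> 0) (at_right 0)"
begin

sublocale lim: density_measure m p "restr \<mu> V"
  by (rule density_measure_restr[OF Radon V])

sublocale seq: density_measure m p "restr (\<mu>s n) V" for n
  by (rule density_measure_restr[OF Radon_s V])

lemma sets_s [simp, measurable_cong]: "sets (\<mu>s n) = sets borel"
  using Radon_s by (simp add: Radon_measure_def)

text \<open>\<open>B3\<close> gives the bound for \<open>x\<close> in \<open>closure V\<close> only.
  The restricted measure is carried by the open set \<open>V\<close>, so the maximum principle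
  extends the bound to every \<open>x\<close>.\<close>

lemma flow_uniformly_small:
  assumes "0 < c"
  obtains t where "0 < t" "\<And>n x. (\<integral>\<^sup>+s\<in>{0<..t}. flow (restr (\<mu>s n) V) s x \<partial>lborel) \<le> c"
proof -
  have "eventually (\<lambda>t. (SUP n. SUP x\<in>closure V. \<integral>\<^sup>+s\<in>{0<..t}. (\<integral>\<^sup>+y\<in>closure V. p s x y \<partial>\<mu>s n) \<partial>lborel) < c) (at_right 0)"
    by (intro order_tendstoD[OF B3] assms)
  then obtain b :: real where b: "0 < b" "\<And>t. 0 < t \<Longrightarrow> t < b \<Longrightarrow>
      (SUP n. SUP x\<in>closure V. \<integral>\<^sup>+s\<in>{0<..t}. (\<integral>\<^sup>+y\<in>closure V. p s x y \<partial>\<mu>s n) \<partial>lborel) < c"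
    unfolding eventually_at_right_field by auto
  define t where "t = b / 2"
  have t: "0 < t" "t < b" using b by (auto simp: t_def)
  have "(\<integral>\<^sup>+s\<in>{0<..t}. flow (restr (\<mu>s n) V) s x \<partial>lborel) \<le> c" for n x
  proof (rule seq.maximum_principle[OF V(1) AE_restr[OF sets_s V(1)] t(1)])
    fix x assume "x \<in> V"
    then have x: "x \<in> closure V" using closure_subset by auto
    have "(\<integral>\<^sup>+s\<in>{0<..t}. flow (restr (\<mu>s n) V) s x \<partial>lborel)
        \<le> (\<integral>\<^sup>+s\<in>{0<..t}. (\<integral>\<^sup>+y\<in>closure V. p s x y \<partial>\<mu>s n) \<partial>lborel)"
      unfolding flow_def
    proof (intro nn_integral_mono mult_right_mono)
      fix s
      have "(\<integral>\<^sup>+y. p s x y \<partial>restr (\<mu>s n) V) = (\<integral>\<^sup>+y\<in>V. p s x y \<partial>\<mu>s n)"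
        by (rule nn_integral_restr[OF sets_s V(1)]) measurable
      also have "\<dots> \<le> (\<integral>\<^sup>+y\<in>closure V. p s x y \<partial>\<mu>s n)"
        using closure_subset[of V] by (intro nn_integral_mono) (auto simp: indicator_def)
      finally show "(\<integral>\<^sup>+y. p s x y \<partial>restr (\<mu>s n) V) \<le> (\<integral>\<^sup>+y\<in>closure V. p s x y \<partial>\<mu>s n)" .
    qed auto
    also have "\<dots> \<le> (SUP x\<in>closure V. \<integral>\<^sup>+s\<in>{0<..t}. (\<integral>\<^sup>+y\<in>closure V. p s x y \<partial>\<mu>s n) \<partial>lborel)"
      by (rule SUP_upper[OF x])
    also have "\<dots> \<le> (SUP n. SUP x\<in>closure V. \<integral>\<^sup>+s\<in>{0<..t}. (\<integral>\<^sup>+y\<in>closure V. p s x y \<partial>\<mu>s n) \<partial>lborel)"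
      by (rule SUP_upper) simp
    also have "\<dots> \<le> c" using b(2)[OF t] by simp
    finally show "(\<integral>\<^sup>+s\<in>{0<..t}. flow (restr (\<mu>s n) V) s x \<partial>lborel) \<le> c" .
  qed
  with t(1) show thesis by (rule that)
qed

text \<open>\<open>B3\<close> speaks of the sequence only; the limit measure inherits bounds by
  passage to the limit, which works directly on a window bounded away from time 0, where the kernel
  is continuous.\<close>

lemma discounted_flow_limit_Ioc:
  assumes "0 < a" "\<And>n. discounted_flow (restr (\<mu>s n) V) {a<..b} x \<le> c"
  shows "discounted_flow (restr \<mu> V) {a<..b} x \<le> c"
proof -
  have "continuous_on UNIV ((\<lambda>(x, y). interval_kernel a b x y) \<circ> Pair x)"
    by (intro continuous_on_compose continuous_on_subset[OF interval_kernel_continuous[OF \<open>0 < a\<close>]])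
       (auto intro: continuous_intros)
  then have "(\<lambda>n. \<integral>y. indicator V y * interval_kernel a b x y \<partial>\<mu>s n) \<longlonglongrightarrow> (\<integral>y. indicator V y * interval_kernel a b x y \<partial>\<mu>)"
    by (intro vague_limit_continuity_set[OF lc Radon Radon_s vague V null]) (simp add: comp_def)
  then have "(\<lambda>n. discounted_flow (restr (\<mu>s n) V) {a<..b} x) \<longlonglongrightarrow> discounted_flow (restr \<mu> V) {a<..b} x"
    unfolding discounted_flow_Ioc_eq[OF Radon V \<open>0 < a\<close>] discounted_flow_Ioc_eq[OF Radon_s V \<open>0 < a\<close>]
    by (rule tendsto_ennrealI)
  then show ?thesis by (rule LIMSEQ_le_const2) (use assms in auto)
qed

text \<open>The bound on \<open>I\<close> holds a fortiori on windows inside \<open>I\<close> that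
  avoid time 0; it passes to \<open>\<mu>\<close> on each of them, and Fatou's lemma recovers
  \<open>I\<close> afterwards.\<close>

lemma discounted_flow_limit:
  assumes c: "\<And>n. discounted_flow (restr (\<mu>s n) V) I x \<le> c"
    and a: "\<And>k. 0 < a k" and sub: "\<And>k. {a k<..b k} \<subseteq> I"
    and ex: "\<And>s. s \<in> I \<Longrightarrow> eventually (\<lambda>k::nat. s \<in> {a k<..b k}) sequentially"
  shows "discounted_flow (restr \<mu> V) I x \<le> c"
proof (rule lim.discounted_flow_exhaust_le[OF ex])
  show "discounted_flow (restr \<mu> V) {a k<..b k} x \<le> c" for k
  proof (rule discounted_flow_limit_Ioc[OF a])
    fix n
    have "discounted_flow (restr (\<mu>s n) V) {a k<..b k} x \<le> discounted_flow (restr (\<mu>s n) V) I x"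
      unfolding discounted_flow_def using sub[of k] by (intro nn_integral_mono) (auto simp: indicator_def)
    then show "discounted_flow (restr (\<mu>s n) V) {a k<..b k} x \<le> c" using c by (rule order.trans)
  qed
qed auto

lemma discounted_flow_limit_Ioc0:
  assumes "\<And>n. discounted_flow (restr (\<mu>s n) V) {0<..b} x \<le> c"
  shows "discounted_flow (restr \<mu> V) {0<..b} x \<le> c"
proof (rule discounted_flow_limit[where a = "\<lambda>k. 1 / real (Suc k)" and b = "\<lambda>k. b", OF assms])
  fix s assume "s \<in> {0<..b}"
  then have "0 < s" "s \<le> b" by auto
  have "eventually (\<lambda>k. 1 / real (Suc k) < s) sequentially"
    using lim_const_over_n[THEN LIMSEQ_Suc, of 1] \<open>0 < s\<close> by (intro order_tendstoD) auto
  then show "eventually (\<lambda>k. s \<in> {1 / real (Suc k)<..b}) sequentially"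
    by eventually_elim (use \<open>s \<le> b\<close> in auto)
next
  show "{1 / real (Suc k)<..b} \<subseteq> {0<..b}" for k
    by (subst Ioc_subset_iff) simp
qed auto

lemma discounted_flow_limit_Ioi:
  assumes "0 \<le> a" "\<And>n. discounted_flow (restr (\<mu>s n) V) {a<..} x \<le> c"
  shows "discounted_flow (restr \<mu> V) {a<..} x \<le> c"
\<comment> \<open>Adding \<open>1 / real (Suc k)\<close> keeps the left ends positive even for
  \<open>a = 0\<close>; for small \<open>k\<close> the window may be empty.\<close>
proof (rule discounted_flow_limit[where a = "\<lambda>k. a + 1 / real (Suc k)" and b = real, OF assms(2)])
  fix s assume "s \<in> {a<..}"
  then have "0 < s - a" by auto
  have "eventually (\<lambda>k. 1 / real (Suc k) < s - a) sequentially"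
    using lim_const_over_n[THEN LIMSEQ_Suc, of 1] \<open>0 < s - a\<close> by (intro order_tendstoD) auto
  moreover obtain K where "s < real K" using reals_Archimedean2 by blast
  then have "eventually (\<lambda>k. s < real k) sequentially"
    by (intro eventually_sequentiallyI[of K]) (meson less_le_trans of_nat_mono)
  ultimately show "eventually (\<lambda>k. s \<in> {a + 1 / real (Suc k)<..real k}) sequentially"
    by eventually_elim auto
next
  show "0 < a + 1 / real (Suc k)" for k using assms(1) by (simp add: add_nonneg_pos)
  show "{a + 1 / real (Suc k)<..real k} \<subseteq> {a<..}" for k
    by (auto intro: le_less_trans[rotated])
qed

lemma discounted_flow_tail:
  obtains B where "0 \<le> B"
    "\<And>n a x. 0 \<le> a \<Longrightarrow> discounted_flow (restr (\<mu>s n) V) {a<..} x \<le> ennreal (exp (- a) * B)"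
    "\<And>a x. 0 \<le> a \<Longrightarrow> discounted_flow (restr \<mu> V) {a<..} x \<le> ennreal (exp (- a) * B)"
proof -
  \<comment> \<open>The threshold 1 is a convenient choice: \<open>B\<close> is then the sum of the
    geometric series of ratio \<open>exp (- t)\<close>.\<close>
  obtain t where t: "0 < t" "\<And>n x. (\<integral>\<^sup>+s\<in>{0<..t}. flow (restr (\<mu>s n) V) s x \<partial>lborel) \<le> 1"
    using flow_uniformly_small[of 1] by auto
  define B where "B = 1 / (1 - exp (- t))"
  have "0 \<le> B" using t by (simp add: B_def)
  moreover have 1: "discounted_flow (restr (\<mu>s n) V) {a<..} x \<le> ennreal (exp (- a) * B)" if "0 \<le> a" for n a x
    using seq.discounted_flow_Ioi_le[OF t(1) t(2) that, of n x] \<open>0 \<le> B\<close>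
    unfolding B_def[symmetric] by (simp add: ennreal_mult)
  moreover have "discounted_flow (restr \<mu> V) {a<..} x \<le> ennreal (exp (- a) * B)" if "0 \<le> a" for a x
    by (rule discounted_flow_limit_Ioi[OF that 1[OF that]])
  ultimately show thesis by (rule that)
qed

theorem potential_bounded:
  obtains B where "\<And>n x. potential p (restr (\<mu>s n) V) x \<le> ennreal B" "\<And>x. potential p (restr \<mu> V) x \<le> ennreal B"
proof -
  obtain B where B: "0 \<le> B"
    "\<And>n a x. 0 \<le> a \<Longrightarrow> discounted_flow (restr (\<mu>s n) V) {a<..} x \<le> ennreal (exp (- a) * B)"
    "\<And>a x. 0 \<le> a \<Longrightarrow> discounted_flow (restr \<mu> V) {a<..} x \<le> ennreal (exp (- a) * B)"
    by (rule discounted_flow_tail) blast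
  \<comment> \<open>The potential is the tail from \<open>a = 0\<close>, where the discount factor
    is 1.\<close>
  show thesis
    by (rule that[of B]) (use B(2)[of 0] B(3)[of 0] in
      \<open>simp_all add: seq.potential_eq_discounted_flow lim.potential_eq_discounted_flow\<close>)
qed

text \<open>Time is cut at \<open>\<delta>\<close> and \<open>T\<close>. The two outer parts are
  small uniformly in \<open>n\<close> and \<open>x\<close>, by the estimate near time 0 and the
  exponential tail; the middle part integrates a continuous kernel and converges uniformly on
  \<open>V\<close>.\<close>

theorem potential_uniform_convergence:
  assumes "0 < e"
  shows "\<forall>\<^sub>F n in sequentially. \<forall>x\<in>V.
    \<bar>enn2real (potential p (restr (\<mu>s n) V) x) - enn2real (potential p (restr \<mu> V) x)\<bar> < e"
proof -
  \<comment> \<open>Each potential exceeds its middle part by at most \<open>2 * u\<close>, and the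
    middle parts differ by less than \<open>u\<close>; the total stays below \<open>3 * u\<close>,
    hence below \<open>e\<close>.\<close>
  define u where "u = e / 5"
  have u: "0 < u" using assms by (simp add: u_def)
  obtain \<delta> where \<delta>: "0 < \<delta>" "\<And>n x. (\<integral>\<^sup>+s\<in>{0<..\<delta>}. flow (restr (\<mu>s n) V) s x \<partial>lborel) \<le> ennreal u"
    using flow_uniformly_small[of "ennreal u"] u by auto
  have near: "discounted_flow (restr (\<mu>s n) V) {0<..\<delta>} x \<le> ennreal u" for n x
    using order.trans[OF seq.discounted_flow_Ioc_le[of n 0 \<delta> x]] \<delta>(2) by simp
  have near': "discounted_flow (restr \<mu> V) {0<..\<delta>} x \<le> ennreal u" for x
    by (rule discounted_flow_limit_Ioc0[OF near])
  obtain B where B: "0 \<le> B"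
    "\<And>n a x. 0 \<le> a \<Longrightarrow> discounted_flow (restr (\<mu>s n) V) {a<..} x \<le> ennreal (exp (- a) * B)"
    "\<And>a x. 0 \<le> a \<Longrightarrow> discounted_flow (restr \<mu> V) {a<..} x \<le> ennreal (exp (- a) * B)"
    by (rule discounted_flow_tail) blast
  have "((\<lambda>T. exp (- T) * B) \<longlongrightarrow> 0 * B) at_top"
    by (intro tendsto_mult_right filterlim_compose[OF exp_at_bot filterlim_uminus_at_bot_at_top])
  then have "eventually (\<lambda>T. exp (- T) * B < u) at_top"
    using u by (intro order_tendstoD) auto
  then obtain T where T: "\<delta> \<le> T" "exp (- T) * B < u"
    using eventually_conj[OF eventually_ge_at_top[of \<delta>]] by (metis (mono_tags, lifting) eventually_happens trivial_limit_at_top_linorder)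
  have T0: "0 \<le> T" using T \<delta> by simp
  have far: "discounted_flow (restr (\<mu>s n) V) {T<..} x \<le> ennreal u" for n x
    using B(2)[OF T0] T(2) by (meson ennreal_leI less_imp_le order.trans)
  have far': "discounted_flow (restr \<mu> V) {T<..} x \<le> ennreal u" for x
    using B(3)[OF T0] T(2) by (meson ennreal_leI less_imp_le order.trans)
  let ?I = "\<lambda>\<mu> x. \<integral>y. indicator V y * interval_kernel \<delta> T x y \<partial>\<mu>"
  have I_nonneg: "0 \<le> ?I \<mu>' x" for \<mu>' x
    by (intro Bochner_Integration.integral_nonneg) (auto simp: interval_kernel_nonneg)
  have split: "potential p (restr (\<mu>s n) V) x = discounted_flow (restr (\<mu>s n) V) {0<..\<delta>} x
      + (ennreal (?I (\<mu>s n) x) + discounted_flow (restr (\<mu>s n) V) {T<..} x)" for n x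
    using \<delta>(1) T(1) by (simp add: seq.potential_eq_discounted_flow seq.discounted_flow_split[of 0 \<delta>]
        seq.discounted_flow_split[of \<delta> T] discounted_flow_Ioc_eq[OF Radon_s V])
  have split': "potential p (restr \<mu> V) x = discounted_flow (restr \<mu> V) {0<..\<delta>} x
      + (ennreal (?I \<mu> x) + discounted_flow (restr \<mu> V) {T<..} x)" for x
    using \<delta>(1) T(1) by (simp add: lim.potential_eq_discounted_flow lim.discounted_flow_split[of 0 \<delta>]
        lim.discounted_flow_split[of \<delta> T] discounted_flow_Ioc_eq[OF Radon V])
  have "\<forall>\<^sub>F n in sequentially. \<forall>x\<in>V. \<bar>?I (\<mu>s n) x - ?I \<mu> x\<bar> < u"
    by (rule vague_limit_kernel_uniform[OF lc Radon Radon_s vague V null interval_kernel_continuous[OF \<delta>(1)] u])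
  then show ?thesis
  proof eventually_elim
    case (elim n)
    show ?case
    proof
      fix x assume "x \<in> V"
      then have "\<bar>?I (\<mu>s n) x - ?I \<mu> x\<bar> < u" using elim by blast
      then show "\<bar>enn2real (potential p (restr (\<mu>s n) V) x) - enn2real (potential p (restr \<mu> V) x)\<bar> < e"
        using enn2real_sandwich[OF split[of n x] near far I_nonneg less_imp_le[OF u]]
          enn2real_sandwich[OF split'[of x] near' far' I_nonneg less_imp_le[OF u]]
        unfolding u_def by linarith
    qed
  qed
qed

end

section \<open>Densities of standard processes\<close>

text \<open>By normality and right continuity at time 0, almost every path lies in \<open>W\<close>
  at all times \<open>s n\<close> with \<open>n\<close> large; dominated convergence passes this to
  the probabilities.\<close>

lemma (in standard_process) law_near_start:
  assumes "open W" "y \<in> W" and s: "\<And>n::nat. 0 < s n" "s \<longlonglongrightarrow> 0"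
  shows "(\<lambda>n. emeasure (law X (Some y)) {\<omega> \<in> samples X. path X (ennreal (s n)) \<omega> \<in> Some ` W}) \<longlonglongrightarrow> 1"
proof -
  interpret P: prob_space "law X (Some y)" by (rule prob_space_law)
  define A where "A n = {\<omega> \<in> samples X. path X (ennreal (s n)) \<omega> \<in> Some ` W}" for n
  have W: "openin top_Delta (Some ` W)"
    using assms(1) by (simp add: top_Delta_def)
  then have "Some ` W \<in> sets borel_Delta"
    unfolding borel_Delta_def by (subst sets_measure_of) auto
  moreover have "A n = path X (ennreal (s n)) -` (Some ` W) \<inter> samples X" for n
    by (auto simp: A_def)
  ultimately have A: "A n \<in> sets (law X (Some y))" for n
    using measurable_sets[OF path_measurable] by (simp add: sets_law)
  have sp: "space (law X (Some y)) = samples X"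
    using sets_eq_imp_space_eq[OF sets_law] .
  have "(\<lambda>n. ennreal (s n)) \<longlonglongrightarrow> ennreal 0"
    by (intro tendsto_ennrealI s)
  \<comment> \<open>Strict positivity of the \<open>s n\<close> turns convergence to 0 into
    convergence from the right.\<close>
  then have right: "filterlim (\<lambda>n. ennreal (s n)) (at_right 0) sequentially"
    by (intro tendsto_imp_filterlim_at_right) (auto simp: s)
  have "(\<lambda>n. \<integral>\<^sup>+\<omega>. indicator (A n) \<omega> \<partial>law X (Some y)) \<longlonglongrightarrow> (\<integral>\<^sup>+\<omega>. 1 \<partial>law X (Some y))"
  proof (rule nn_integral_dominated_convergence[where w = "\<lambda>_. 1"])
    show "AE \<omega> in law X (Some y). (\<lambda>n. indicator (A n) \<omega> :: ennreal) \<longlonglongrightarrow> 1"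
      using normal[of "Some y"] AE_space
    proof eventually_elim
      case (elim \<omega>)
      then have \<omega>: "\<omega> \<in> samples X" by (simp add: sp)
      from right_continuous[OF this, of 0]
      have "limitin top_Delta (\<lambda>s. path X s \<omega>) (Some y) (at_right 0)" using elim by simp
      then have "eventually (\<lambda>t. path X t \<omega> \<in> Some ` W) (at_right 0)"
        using W \<open>y \<in> W\<close> by (auto simp: limitin_def)
      then have "eventually (\<lambda>n. path X (ennreal (s n)) \<omega> \<in> Some ` W) sequentially"
        using right by (auto simp: filterlim_iff)
      then have "eventually (\<lambda>n. indicator (A n) \<omega> = (1 :: ennreal)) sequentially"
        by eventually_elim (simp add: A_def \<omega>)
      then show ?case by (rule tendsto_eventually)
    qed
  qed (use A P.emeasure_space_1 in \<open>auto simp: indicator_def\<close>)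
  then show ?thesis
    using A P.emeasure_space_1 by (simp add: A_def)
qed

text \<open>The restriction is absolutely continuous with respect to \<open>\<mu>\<close>. A
  semipolar set need not be measurable, hence the detour through a measurable null superset
  \<open>N\<close>.\<close>

lemma charges_no_semipolar_restr:
  assumes "charges_no_semipolar X \<mu>" "V \<in> sets \<mu>"
  shows "charges_no_semipolar X (restr \<mu> V)"
  unfolding charges_no_semipolar_def
proof (intro allI impI)
  fix A assume "semipolar X A"
  then have "A \<in> null_sets (completion \<mu>)" using assms by (simp add: charges_no_semipolar_def)
  then obtain N where N: "A \<subseteq> N" "N \<in> null_sets \<mu>" by (auto simp: null_sets_completion_iff2)
  have "N \<in> null_sets (restr \<mu> V)"
    unfolding restr_def using N(2) assms(2)
    by (subst null_sets_density_iff) (auto intro: AE_not_in AE_mp[OF AE_not_in])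
  then show "A \<in> null_sets (completion (restr \<mu> V))"
    using N(1) by (auto simp: null_sets_completion_iff2)
qed

text \<open>\<open>X\<close> gives the sub-Markov bound, the missing mass sitting at the cemetery;
  \<open>Xh\<close> gives \<open>concentration\<close>. Extension by 0 turns measurability on
  positive times into measurability on all times.\<close>

lemma submarkov_density_of_transition_density:
  fixes X :: "('w, 'a::{metric_space, second_countable_topology}) process"
    and Xh :: "('v, 'a) process"
  assumes X: "standard_process X" and Xh: "standard_process Xh"
    and m: "sets m = sets borel" "sigma_finite_measure m"
    and p: "transition_density X Xh m p"
    and cont: "continuous_on ({0<..} \<times> UNIV) (\<lambda>(t, x, y). p t x y)"
    and fin: "\<And>t x y. t > 0 \<Longrightarrow> p t x y < \<infinity>"
  defines "q \<equiv> \<lambda>t x y. if 0 < t then p t x y else 0"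
  shows "submarkov_density m q"
proof -
  interpret X: standard_process X by fact
  interpret Xh: standard_process Xh by fact
  interpret sigma_finite_measure m by fact
  show ?thesis
  proof
    show "sets m = sets borel" by fact
    have "(\<lambda>(t, x, y). p t x y) \<in> borel_measurable (restrict_space borel ({0<..} \<times> UNIV))"
      using p by (simp add: transition_density_def)
    then have "(\<lambda>w. (case w of (t, x, y) \<Rightarrow> p t x y) * indicator ({0<..} \<times> UNIV) w) \<in> borel_measurable borel"
      by (subst (asm) borel_measurable_restrict_space_iff_ennreal) (auto intro!: borel_open open_Times)
    moreover have "(\<lambda>w. (case w of (t, x, y) \<Rightarrow> p t x y) * indicator ({0<..} \<times> UNIV) w) = (\<lambda>(t, x, y). q t x y)"
      by (auto simp: q_def indicator_def)
    ultimately show "(\<lambda>(t, x, y). q t x y) \<in> borel_measurable (borel \<Otimes>\<^sub>M borel \<Otimes>\<^sub>M borel)"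
      by (simp add: borel_prod)
    show "q (s + t) x y = (\<integral>\<^sup>+z. q s x z * q t z y \<partial>m)" if "0 < s" "0 < t" for s t x y
      using p that by (simp add: transition_density_def q_def)
    show "(\<integral>\<^sup>+z. q t x z \<partial>m) \<le> 1" if "0 < t" for t x
    proof -
      have "(\<integral>\<^sup>+z. q t x z \<partial>m) = (\<integral>\<^sup>+z\<in>UNIV. p t x z \<partial>m)" using that by (simp add: q_def)
      also have "\<dots> = emeasure (law X (Some x)) {\<omega> \<in> samples X. path X (ennreal t) \<omega> \<in> Some ` UNIV}"
      proof -
        have "\<forall>t>0. \<forall>x. \<forall>E\<in>sets borel.
          emeasure (law X (Some x)) {\<omega> \<in> samples X. path X (ennreal t) \<omega> \<in> Some ` E} = (\<integral>\<^sup>+y\<in>E. p t x y \<partial>m)"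
          using p by (simp add: transition_density_def)
        from this[rule_format, OF that, of UNIV x] show ?thesis by simp
      qed
      also have "\<dots> \<le> 1"
        by (rule prob_space.emeasure_le_1[OF X.prob_space_law])
      finally show ?thesis .
    qed
    show "(\<lambda>n::nat. \<integral>\<^sup>+z\<in>W. q (s n) z y \<partial>m) \<longlonglongrightarrow> 1"
      if W: "open W" "y \<in> W" and s: "\<And>n. 0 < s n" "s \<longlonglongrightarrow> 0" for W y s
    proof -
      have "emeasure (law Xh (Some y)) {\<omega> \<in> samples Xh. path Xh (ennreal (s n)) \<omega> \<in> Some ` W}
          = (\<integral>\<^sup>+z\<in>W. q (s n) z y \<partial>m)" for n
        using p s(1)[of n] W(1) by (simp add: transition_density_def q_def)
      with Xh.law_near_start[OF W s] show ?thesis by simp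
    qed
    show "continuous_on ({0<..} \<times> UNIV) (\<lambda>(t, x, y). q t x y)"
      using cont by (rule continuous_on_eq) (auto simp: q_def)
    show "q t x y < \<infinity>" if "0 < t" for t x y
      using fin that by (simp add: q_def)
  qed
qed

text \<open>Both restrictions vanish off \<open>V\<close>, so a bound on \<open>V\<close> holds
  almost everywhere; \<open>0 < e\<close> makes \<open>e\<close> a competitor in the
  infimum.\<close>

lemma Linfty_norm_le:
  assumes sets: "sets \<mu> = sets borel" "sets \<nu> = sets borel" and "open V" and "0 < e"
    and le: "\<And>x. x \<in> V \<Longrightarrow> \<bar>f x\<bar> \<le> ereal e"
  shows "Linfty_norm (add_measure (restr \<mu> V) (restr \<nu> V)) f \<le> ereal e"
proof -
  have V: "V \<in> sets borel" using \<open>open V\<close> by simp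
  have restr0: "emeasure (restr \<rho> V) (- V) = 0" if "sets \<rho> = sets borel" for \<rho>
    using that V by (simp add: restr_def emeasure_density indicator_def nn_integral_0_iff_AE)
  have s: "sets (restr \<rho> V) = sets borel" if "sets \<rho> = sets borel" for \<rho>
    using that by (simp add: restr_def)
  have "emeasure (add_measure (restr \<mu> V) (restr \<nu> V)) (- V) = 0"
    using sets V by (subst emeasure_add_measure) (auto simp: s restr0)
  moreover have "sets (add_measure (restr \<mu> V) (restr \<nu> V)) = sets (restr \<mu> V)"
    by (simp add: add_measure_def)
  ultimately have "AE x in add_measure (restr \<mu> V) (restr \<nu> V). x \<notin> - V"
    using V by (intro AE_not_in) (auto simp: null_sets_def s[OF sets(1)])
  then have "AE x in add_measure (restr \<mu> V) (restr \<nu> V). \<bar>f x\<bar> \<le> ereal e"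
    by eventually_elim (simp add: le)
  then show ?thesis
    unfolding Linfty_norm_def using \<open>0 < e\<close> by (intro Inf_lower) auto
qed

lemma Linfty_norm_nonneg: "0 \<le> Linfty_norm \<nu> f"
  unfolding Linfty_norm_def by (intro Inf_greatest) auto

theorem theorem4p2:
  fixes X :: "('w, 'a::{metric_space, second_countable_topology}) process"
    and Xh :: "('v, 'a) process"
    and m :: "'a measure"
    and p :: "real \<Rightarrow> 'a \<Rightarrow> 'a \<Rightarrow> ennreal"
    and \<mu> :: "'a measure"
    and \<mu>s :: "nat \<Rightarrow> 'a measure"
  assumes "locally_compact_space (euclidean :: 'a topology)"
    and "standard_process X"
    and "standard_process Xh"
    and "sets m = sets borel" and "sigma_finite_measure m"
    and "transition_density X Xh m p"
    and "Radon_measure \<mu>" and "\<And>n. Radon_measure (\<mu>s n)"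
    and B1: "continuous_on ({0<..} \<times> UNIV) (\<lambda>(t, x, y). p t x y)"
            "\<And>t x y. t > 0 \<Longrightarrow> p t x y < \<infinity>"
    and B2: "charges_no_semipolar X \<mu>" "\<And>n. charges_no_semipolar X (\<mu>s n)"
            "vague_limit \<mu>s \<mu>"
    and B3: "\<And>K. compact K \<Longrightarrow>
      ((\<lambda>t. SUP n. SUP x\<in>K. \<integral>\<^sup>+s\<in>{0<..t}. (\<integral>\<^sup>+y\<in>K. p s x y \<partial>\<mu>s n) \<partial>lborel) \<longlongrightarrow> 0) (at_right 0)"
  shows "\<exists>V :: nat \<Rightarrow> 'a set. incseq V \<and> (\<forall>k. open (V k) \<and> compact (closure (V k))) \<and>
    (\<Union>k. V k) = UNIV \<and>
    (\<forall>k. restr \<mu> (V k) \<in> S00 X p \<and> (\<forall>n. restr (\<mu>s n) (V k) \<in> S00 X p) \<and>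
      (\<lambda>n. Linfty_norm (add_measure (restr (\<mu>s n) (V k)) (restr \<mu> (V k)))
        (\<lambda>x. enn2ereal (potential p (restr (\<mu>s n) (V k)) x)
           - enn2ereal (potential p (restr \<mu> (V k)) x))) \<longlonglongrightarrow> 0)"
proof -
  \<comment> \<open>\<open>p\<close> is arbitrary, possibly not measurable, at times \<open>t \<le> 0\<close>.\<close>
  define q where "q t x y = (if 0 < t then p t x y else 0)" for t x y
  interpret submarkov_density m q
    unfolding q_def[abs_def] by (rule submarkov_density_of_transition_density) fact+
  have potential_q: "potential p = potential q"
    by (intro ext) (auto simp: potential_def resolvent_density_def q_def indicator_def intro!: nn_integral_cong)
  obtain V :: "nat \<Rightarrow> 'a set" where V: "incseq V" "\<And>k. open (V k)" "\<And>k. compact (closure (V k))"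
    "(\<Union>k. V k) = UNIV" "\<And>k. emeasure \<mu> (frontier (V k)) = 0"
    by (rule Radon_exhaustion[OF assms(1,7)]) blast
  have sets: "sets \<mu> = sets borel" "sets (\<mu>s n) = sets borel" for n
    using assms(7,8) by (auto simp: Radon_measure_def)
  have "restr \<mu> (V k) \<in> S00 X p \<and> (\<forall>n. restr (\<mu>s n) (V k) \<in> S00 X p) \<and>
      (\<lambda>n. Linfty_norm (add_measure (restr (\<mu>s n) (V k)) (restr \<mu> (V k)))
        (\<lambda>x. enn2ereal (potential p (restr (\<mu>s n) (V k)) x)
           - enn2ereal (potential p (restr \<mu> (V k)) x))) \<longlonglongrightarrow> 0" for k
  proof -
    \<comment> \<open>Only times in \<open>{0<..t}\<close> enter, where \<open>q\<close> and
      \<open>p\<close> agree, so (B3) passes to \<open>q\<close>.\<close>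
    have "(\<lambda>t. SUP n. SUP x\<in>closure (V k). \<integral>\<^sup>+s\<in>{0<..t}. (\<integral>\<^sup>+y\<in>closure (V k). q s x y \<partial>\<mu>s n) \<partial>lborel)
      = (\<lambda>t. SUP n. SUP x\<in>closure (V k). \<integral>\<^sup>+s\<in>{0<..t}. (\<integral>\<^sup>+y\<in>closure (V k). p s x y \<partial>\<mu>s n) \<partial>lborel)"
      by (intro ext SUP_cong refl nn_integral_cong) (auto simp: q_def indicator_def)
    with B3[OF V(3)[of k]] interpret vs: vague_setting m q \<mu> \<mu>s "V k"
      by unfold_locales (use assms V in simp_all)
    obtain B where B: "\<And>n x. potential q (restr (\<mu>s n) (V k)) x \<le> ennreal B"
      "\<And>x. potential q (restr \<mu> (V k)) x \<le> ennreal B"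
      by (rule vs.potential_bounded) blast
    have S: "restr \<rho> (V k) \<in> S00 X p"
      if "Radon_measure \<rho>" "charges_no_semipolar X \<rho>" "\<And>x. potential q (restr \<rho> (V k)) x \<le> ennreal B" for \<rho>
    proof -
      interpret \<rho>: density_measure m q "restr \<rho> (V k)" by (rule density_measure_restr[OF that(1) V(2,3)])
      have "(SUP x. potential q (restr \<rho> (V k)) x) \<le> ennreal B" by (intro SUP_least that)
      also have "\<dots> < \<infinity>" by simp
      finally have "(SUP x. potential q (restr \<rho> (V k)) x) < \<infinity>" .
      moreover have "charges_no_semipolar X (restr \<rho> (V k))"
        using that V(2) by (intro charges_no_semipolar_restr) (auto simp: Radon_measure_def)
      ultimately show ?thesis
        unfolding S00_def potential_q using \<rho>.\<nu>.finite_measure_axioms \<rho>.sets_nu by simp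
    qed
    let ?L = "\<lambda>n. Linfty_norm (add_measure (restr (\<mu>s n) (V k)) (restr \<mu> (V k)))
        (\<lambda>x. enn2ereal (potential p (restr (\<mu>s n) (V k)) x) - enn2ereal (potential p (restr \<mu> (V k)) x))"
    \<comment> \<open>The common bound \<open>B\<close> makes both potentials finite, so their
      difference in the extended reals is a real difference.\<close>
    have ereal: "enn2ereal a = ereal (enn2real a)" if "a \<le> ennreal B" for a
      using that by (cases a) (auto simp: top_unique enn2ereal_ennreal)
    have "?L \<longlonglongrightarrow> 0"
    proof (rule order_tendstoI)
      fix a :: ereal assume "a < 0"
      then show "eventually (\<lambda>n. a < ?L n) sequentially"
        by (intro always_eventually allI less_le_trans[OF _ Linfty_norm_nonneg])
    next
      fix a :: ereal assume "0 < a"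
      \<comment> \<open>\<open>a\<close> may be infinite, so a real tolerance is interposed between
        0 and \<open>a\<close>.\<close>
      then obtain e where e: "0 < ereal e" "ereal e < a" using ereal_dense2 by blast
      then have "0 < e" by simp
      from vs.potential_uniform_convergence[OF this]
      show "eventually (\<lambda>n. ?L n < a) sequentially"
      proof eventually_elim
        case (elim n)
        have "?L n \<le> ereal e"
          using elim B unfolding potential_q
          by (intro Linfty_norm_le sets V \<open>0 < e\<close>) (auto simp: ereal intro: less_imp_le)
        then show ?case using e(2) by (rule le_less_trans)
      qed
    qed
    moreover have "restr \<mu> (V k) \<in> S00 X p"
      by (rule S[OF assms(7) B2(1) B(2)])
    moreover have "restr (\<mu>s n) (V k) \<in> S00 X p" for n
      by (rule S[OF assms(8) B2(2) B(1)])
    ultimately show ?thesis by simp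
  qed
  then show ?thesis
    by (intro exI[of _ V] conjI allI) (use V in simp_all)
qed

end
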